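(* One has $\hat{\Delta}(K)=K\otimes K$, and $$K_0\odot E_0+E_0\odot K_0^{-1}\subset\hat{\Delta}(E)\qquad\text{and}\qquad K_0\odot E_0^\dagger+E_0^\dagger\odot K_0^{-1}\subset\hat{\Delta}(E^* ).$$
   Context: Special functions. Fix $0<q<1$. $\mathbb{N}=\{1,2,\dots\}$, $\mathbb{N}_0=\mathbb{N}\cup\{0\}$, $I_q=-q^{\mathbb{N}}\cup q^{\mathbb{Z}}$. For $x\in -q^{\mathbb{Z}}\cup q^{\mathbb{Z}}$: $\chi(x)=\log_q|x|$ and $\nu(x)=q^{\frac12(\chi(x)-1)(\chi(x)-2)}$. For real $x$: $\kappa(x)=\mathrm{sgn}(x)x^2$. For nonzero real $x,y$: $s(x,y)=-1$ if $x>0$ and $y<0$, and $s(x,y)=1$ otherwise. $(a;q)_\infty=\prod_{k\ge 0}(1-aq^k)$, $(a;q)_n=(a;q)_\infty/(aq^n;q)_\infty$, $(a_1,\dots,a_k;q)_n=\prod_i(a_i;q)_n$. $c_q=(\sqrt2\,q\,(q^2,-q^2;q^2)_\infty)^{-1}$ and $\Psi(a;b;q,z)=\sum_{n\ge 0}\frac{(a;q)_n(bq^n;q)_\infty}{(q;q)_n}(-1)^nq^{n(n-1)/2}z^n$. For $p,x,y\in I_q$ put $a_p(x,y)=0$ if $\mathrm{sgn}(xy)\ne\mathrm{sgn}(p)$ and otherwise $$a_p(x,y)=c_q\,s(x,y)(-1)^{\chi(p)}(-\mathrm{sgn}(y))^{\chi(x)}|y|\,\nu(py/x)\sqrt{\frac{(-\kappa(p),-\kappa(y);q^2)_\infty}{(-\kappa(x);q^2)_\infty}}\;\Psi\bigl(-q^2/\kappa(y);\,q^2\kappa(x/y);\,q^2,\,q^2\kappa(x/p)\bigr).$$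 Quantum group. $\mathcal{K}=L^2(\mathbb{T})\otimes\ell^2(I_q)\otimes\ell^2(I_q)$ with orthonormal basis $f_{m,p,t}=\zeta^m\otimes\delta_p\otimes\delta_t$ ($m\in\mathbb{Z}$, $p,t\in I_q$; also written $f_{mpt}$), $\zeta$ the identity function on the unit circle $\mathbb{T}$. $W\in B(\mathcal{K}\otimes\mathcal{K})$ is the (multiplicative) unitary with $$W^*(f_{m_1,p_1,t_1}\otimes f_{m_2,p_2,t_2})=\sum_{y,z\in I_q,\ \mathrm{sgn}(p_2t_2)yzq^{m_2}/p_1\in I_q}\Bigl|\tfrac{t_2}{y}\Bigr|a_{t_2}(p_1,y)\,a_{p_2}\bigl(z,\mathrm{sgn}(p_2t_2)yzq^{m_2}/p_1\bigr)\,f_{m_1+m_2-\chi(p_1p_2/t_2z),\,z,\,t_1}\otimes f_{\chi(p_1p_2/t_2z),\,\mathrm{sgn}(p_2t_2)yzq^{m_2}/p_1,\,y}.$$ $\hat M$ is the von Neumann algebra on $\mathcal{K}$ that is the $\sigma$-strong-$*$ closure of $\{(\omega\otimes\mathrm{Id})(W):\omega\in B(\mathcal{K})_*\}$. With $\Sigma$ the flip operator on $\mathcal{K}\otimes\mathcal{K}$, the dual comultiplication is $\hat\Delta(x)=\Sigma W(x\otimes1)W^*\Sigma$, both for $x\in\hat M$ and for closed densely defined operators $x$ affiliated to $\hat M$ (such as $K$, $E$, $E^*$ below). Operators. $\mathcal{K}_0\subset\mathcal{K}$ is the linear span of the $f_{mpt}$. On $\mathcal{K}_0$ define $K_0f_{mpt}=q^{-m/2}|p/t|^{1/2}f_{mpt}$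 and $$(q-q^{-1})E_0f_{mpt}=\mathrm{sgn}(t)\,q^{-\frac{m-1}{2}}|p/t|^{1/2}\sqrt{1+\kappa(q^{-1}t)}\,f_{m-1,p,q^{-1}t}-\mathrm{sgn}(p)\,q^{\frac{m-1}{2}}|t/p|^{1/2}\sqrt{1+\kappa(p)}\,f_{m-1,qp,t}$$ (terms with label outside $I_q$ have zero coefficient and are read as $0$). $E_0^\dagger:\mathcal{K}_0\to\mathcal{K}_0$ is the formal adjoint of $E_0$: $\langle E_0v,w\rangle=\langle v,E_0^\dagger w\rangle$, $v,w\in\mathcal{K}_0$. $K$ and $E$ are the closures of $K_0$ and $E_0$. $\odot$ denotes the algebraic tensor product of operators, with domain $\mathcal{K}_0\odot\mathcal{K}_0\subset\mathcal{K}\otimes\mathcal{K}$; $K\otimes K$ is the closed tensor product. *)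

theory Defs
  imports "HOL-Analysis.Analysis"
begin

section \<open>Complex Hilbert spaces \<open>\<ell>\<^sup>2(X)\<close>\<close>

typedef 'a ell2 = "{f :: 'a \<Rightarrow> complex. (\<lambda>i. (cmod (f i))\<^sup>2) summable_on UNIV}"
  morphisms coord Abs_ell2
  by (rule exI[of _ "\<lambda>_. 0"]) simp

setup_lifting type_definition_ell2

lemma coord_summable: "(\<lambda>i. (cmod (coord v i))\<^sup>2) summable_on UNIV"
  using coord[of v] by simp

lemma ell2_eqI: "(\<And>i. coord v i = coord w i) \<Longrightarrow> v = w"
  by (simp add: coord_inject[symmetric] fun_eq_iff)

lemma square_summable_scale:
  assumes "(\<lambda>i. (cmod (f i))\<^sup>2) summable_on A"
  shows "(\<lambda>i. (cmod (c * f i))\<^sup>2) summable_on A"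
  using summable_on_cmult_right[OF assms, of "(cmod c)\<^sup>2"]
  by (simp add: norm_mult power_mult_distrib)

lemma square_summable_add:
  assumes "(\<lambda>i. (cmod (f i))\<^sup>2) summable_on A" "(\<lambda>i. (cmod (g i))\<^sup>2) summable_on A"
  shows "(\<lambda>i. (cmod (f i + g i))\<^sup>2) summable_on A"
proof (rule summable_on_comparison_test)
  show "(\<lambda>i. 2 * (cmod (f i))\<^sup>2 + 2 * (cmod (g i))\<^sup>2) summable_on A"
    using assms by (intro summable_on_add summable_on_cmult_right)
  fix i
  have "(cmod (f i + g i))\<^sup>2 \<le> (cmod (f i) + cmod (g i))\<^sup>2"
    by (intro power_mono norm_triangle_ineq) simp
  also have "\<dots> \<le> 2 * (cmod (f i))\<^sup>2 + 2 * (cmod (g i))\<^sup>2"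
    using zero_le_power2[of "cmod (f i) - cmod (g i)"] by (simp add: power2_eq_square algebra_simps)
  finally show "(cmod (f i + g i))\<^sup>2 \<le> 2 * (cmod (f i))\<^sup>2 + 2 * (cmod (g i))\<^sup>2" .
qed auto

lemma cinner_abs_summable: "(\<lambda>i. norm (coord v i * cnj (coord w i))) summable_on UNIV"
proof (rule summable_on_comparison_test)
  show "(\<lambda>i. (cmod (coord v i))\<^sup>2 + (cmod (coord w i))\<^sup>2) summable_on UNIV"
    by (intro summable_on_add coord_summable)
  fix i
  show "norm (coord v i * cnj (coord w i)) \<le> (cmod (coord v i))\<^sup>2 + (cmod (coord w i))\<^sup>2"
    using sum_squares_bound[of "cmod (coord v i)" "cmod (coord w i)"]
      mult_nonneg_nonneg[OF norm_ge_zero[of "coord v i"] norm_ge_zero[of "coord w i"]]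
    unfolding norm_mult complex_mod_cnj mult.assoc by linarith
qed simp

lemma cinner_summable: "(\<lambda>i. coord v i * cnj (coord w i)) summable_on UNIV"
  by (rule abs_summable_summable[OF cinner_abs_summable])

lift_definition scaleC :: "complex \<Rightarrow> 'a ell2 \<Rightarrow> 'a ell2"
  is "\<lambda>c f i. c * f i"
  by (rule square_summable_scale)

definition cinner :: "'a ell2 \<Rightarrow> 'a ell2 \<Rightarrow> complex"
  where "cinner v w = (\<Sum>\<^sub>\<infinity>i. coord v i * cnj (coord w i))"

instantiation ell2 :: (type) real_inner
begin

lift_definition zero_ell2 :: "'a ell2" is "\<lambda>_. 0" by simp

lift_definition plus_ell2 :: "'a ell2 \<Rightarrow> 'a ell2 \<Rightarrow> 'a ell2" is "\<lambda>f g i. f i + g i"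
  by (rule square_summable_add)

lift_definition uminus_ell2 :: "'a ell2 \<Rightarrow> 'a ell2" is "\<lambda>f i. - f i"
  by simp

definition minus_ell2 :: "'a ell2 \<Rightarrow> 'a ell2 \<Rightarrow> 'a ell2"
  where "minus_ell2 v w = v + (- w)"

definition scaleR_ell2 :: "real \<Rightarrow> 'a ell2 \<Rightarrow> 'a ell2"
  where "scaleR_ell2 r v = scaleC (complex_of_real r) v"

definition inner_ell2 :: "'a ell2 \<Rightarrow> 'a ell2 \<Rightarrow> real"
  where "inner_ell2 v w = Re (cinner v w)"

definition norm_ell2 :: "'a ell2 \<Rightarrow> real"
  where "norm_ell2 v = sqrt (inner v v)"

definition sgn_ell2 :: "'a ell2 \<Rightarrow> 'a ell2"
  where "sgn_ell2 v = scaleR (inverse (norm v)) v"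

definition dist_ell2 :: "'a ell2 \<Rightarrow> 'a ell2 \<Rightarrow> real"
  where "dist_ell2 v w = norm (v - w)"

definition uniformity_ell2 :: "('a ell2 \<times> 'a ell2) filter"
  where "uniformity_ell2 = (INF e\<in>{0<..}. principal {(x, y). dist x y < e})"

definition open_ell2 :: "'a ell2 set \<Rightarrow> bool"
  where "open_ell2 U = (\<forall>x\<in>U. eventually (\<lambda>(x', y). x' = x \<longrightarrow> y \<in> U) uniformity)"

lemma coord_simps:
  "coord 0 i = 0" "coord (v + w) i = coord v i + coord w i" "coord (- v) i = - coord v i"
  "coord (v - w) i = coord v i - coord w i" "coord (scaleC c v) i = c * coord v i"
  "coord (r *\<^sub>R v) i = complex_of_real r * coord v i"
  by (simp_all add: minus_ell2_def scaleR_ell2_def zero_ell2.rep_eq plus_ell2.rep_eq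
      uminus_ell2.rep_eq scaleC.rep_eq)

lemma inner_self: "inner v v = (\<Sum>\<^sub>\<infinity>i. (cmod (coord v i))\<^sup>2)" for v :: "'a ell2"
proof -
  have "inner v v = (\<Sum>\<^sub>\<infinity>i. Re (coord v i * cnj (coord v i)))"
    unfolding inner_ell2_def cinner_def using infsum_Re[OF cinner_summable[of v v]] by simp
  also have "\<dots> = (\<Sum>\<^sub>\<infinity>i. (cmod (coord v i))\<^sup>2)"
    by (rule infsum_cong) (simp add: complex_norm_square[symmetric])
  finally show ?thesis .
qed

instance
proof
  fix u v w :: "'a ell2" and a b r :: real
  show "u + v + w = u + (v + w)" "u + v = v + u" "0 + u = u" "- u + u = 0" "u - v = u + - v"
    by (auto intro!: ell2_eqI simp: coord_simps)
  show "a *\<^sub>R (u + v) = a *\<^sub>R u + a *\<^sub>R v" "(a + b) *\<^sub>R u = a *\<^sub>R u + b *\<^sub>R u"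
    "a *\<^sub>R b *\<^sub>R u = (a * b) *\<^sub>R u" "1 *\<^sub>R u = u"
    by (auto intro!: ell2_eqI simp: coord_simps algebra_simps)
  show "inner u v = inner v u"
  proof -
    have "cinner u v = (\<Sum>\<^sub>\<infinity>i. cnj (coord v i * cnj (coord u i)))"
      unfolding cinner_def by (rule infsum_cong) simp
    also have "\<dots> = cnj (cinner v u)"
      unfolding cinner_def by (rule infsum_cnj)
    finally show ?thesis by (simp add: inner_ell2_def)
  qed
  show "inner (u + v) w = inner u w + inner v w"
    unfolding inner_ell2_def cinner_def
    by (simp add: coord_simps algebra_simps infsum_add[OF cinner_summable cinner_summable])
  show "inner (r *\<^sub>R u) v = r * inner u v"
    unfolding inner_ell2_def cinner_def
    by (simp add: coord_simps mult.assoc infsum_cmult_right[OF cinner_summable])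
  show "0 \<le> inner u u"
    unfolding inner_self by (rule infsum_nonneg) simp
  show "inner u u = 0 \<longleftrightarrow> u = 0"
  proof
    assume "inner u u = 0"
    then have *: "(\<Sum>\<^sub>\<infinity>i. (cmod (coord u i))\<^sup>2) = 0"
      by (simp add: inner_self)
    have "(cmod (coord u i))\<^sup>2 = 0" for i
      by (rule nonneg_infsum_le_0D[OF _ coord_summable]) (simp_all add: *)
    then show "u = 0"
      by (intro ell2_eqI) (simp add: coord_simps)
  qed (simp add: inner_self coord_simps)
  show "norm u = sqrt (inner u u)" by (rule norm_ell2_def)
  show "sgn u = scaleR (inverse (norm u)) u" by (rule sgn_ell2_def)
  show "dist u v = norm (u - v)" by (rule dist_ell2_def)
  show "uniformity = (INF e\<in>{0<..}. principal {(x, y). dist (x::'a ell2) y < e})"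
    by (rule uniformity_ell2_def)
  show "open U = (\<forall>x\<in>U. eventually (\<lambda>(x', y). x' = x \<longrightarrow> y \<in> U) uniformity)"
    for U :: "'a ell2 set"
    by (rule open_ell2_def)
qed

end

lift_definition ket :: "'a \<Rightarrow> 'a ell2" is "\<lambda>j i. if i = j then 1 else 0"
proof -
  fix j :: 'a
  have "(\<lambda>i. (cmod (if i = j then 1 else 0))\<^sup>2) summable_on {j}" by simp
  then show "(\<lambda>i. (cmod (if i = j then 1 else 0))\<^sup>2) summable_on UNIV"
    by (rule summable_on_cong_neutral[THEN iffD1, rotated -1]) auto
qed

text \<open>The Hilbert space tensor product of \<open>\<ell>\<^sup>2(X)\<close> and \<open>\<ell>\<^sup>2(Y)\<close> is \<open>\<ell>\<^sup>2(X \<times> Y)\<close>.\<close>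

lift_definition tensor :: "'a ell2 \<Rightarrow> 'b ell2 \<Rightarrow> ('a \<times> 'b) ell2" (infixr \<open>\<otimes>\<^sub>v\<close> 75)
  is "\<lambda>f g (i, j). f i * g j"
proof -
  fix f :: "'a \<Rightarrow> complex" and g :: "'b \<Rightarrow> complex"
  assume f: "(\<lambda>i. (cmod (f i))\<^sup>2) summable_on UNIV" and g: "(\<lambda>i. (cmod (g i))\<^sup>2) summable_on UNIV"
  have "(\<lambda>x. norm ((cmod (f (fst x)))\<^sup>2 * (cmod (g (snd x)))\<^sup>2)) summable_on UNIV \<times> UNIV"
    using f g by (intro Infinite_Sum.abs_summable_on_Sigma_iff[THEN iffD2])
      (simp add: abs_mult infsum_cmult_right' infsum_nonneg summable_on_cmult_right summable_on_cmult_left)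
  then show "(\<lambda>x. (cmod (case x of (i, j) \<Rightarrow> f i * g j))\<^sup>2) summable_on UNIV"
    by (simp add: case_prod_unfold norm_mult power_mult_distrib)
qed

definition supported_on :: "'a set \<Rightarrow> 'a ell2 set"
  where "supported_on X = {v. \<forall>i. i \<notin> X \<longrightarrow> coord v i = 0}"

definition scaleC_pair :: "complex \<Rightarrow> 'a ell2 \<times> 'b ell2 \<Rightarrow> 'a ell2 \<times> 'b ell2"
  where "scaleC_pair c = map_prod (scaleC c) (scaleC c)"

global_interpretation cvec: vector_space scaleC
  by unfold_locales (auto intro!: ell2_eqI simp: coord_simps algebra_simps)

global_interpretation cgraph: vector_space scaleC_pair
  by unfold_locales (auto simp: scaleC_pair_def cvec.scale_left_distrib cvec.scale_right_distrib)


section \<open>Unbounded operators\<close>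

text \<open>
  A (not necessarily everywhere defined or bounded) linear operator is represented by its graph,
  so that extension of operators is \<open>\<subseteq>\<close>, the closure of an operator is \<open>closure\<close>, the inverse
  is \<open>converse\<close>, and the operator product \<open>A B\<close> (first \<open>B\<close>, then \<open>A\<close>, with its maximal domain)
  is \<open>B O A\<close>. As \<open>\<ell>\<^sup>2(X)\<close> for a set \<open>X\<close> is a proper subspace of its ambient type, the
  underlying Hilbert space \<open>H\<close> is made explicit where it matters.
\<close>

type_synonym ('a, 'b) operator = "('a ell2 \<times> 'b ell2) set"

definition adj :: "'a ell2 set \<Rightarrow> ('a, 'a) operator \<Rightarrow> ('a, 'a) operator"
  where "adj H A = {(w, w'). w \<in> H \<and> w' \<in> H \<and> (\<forall>(v, v') \<in> A. cinner v' w = cinner v w')}"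

definition unitary_on :: "'a ell2 set \<Rightarrow> ('a, 'a) operator \<Rightarrow> bool"
  where "unitary_on H U \<longleftrightarrow> single_valued U \<and> cgraph.subspace U \<and> Domain U = H \<and> Range U = H \<and>
    (\<forall>(v, v') \<in> U. \<forall>(w, w') \<in> U. cinner v' w' = cinner v w)"

definition op_plus :: "('a, 'b) operator \<Rightarrow> ('a, 'b) operator \<Rightarrow> ('a, 'b) operator"
    (infixl \<open>+\<^sub>o\<close> 65)
  where "A +\<^sub>o B = {(v, a + b) | v a b. (v, a) \<in> A \<and> (v, b) \<in> B}"

definition alg_tensor :: "('a, 'b) operator \<Rightarrow> ('c, 'd) operator \<Rightarrow> ('a \<times> 'c, 'b \<times> 'd) operator"
    (infixr \<open>\<odot>\<close> 70)
  where "A \<odot> B = cgraph.span {(v \<otimes>\<^sub>v w, v' \<otimes>\<^sub>v w') | v v' w w'. (v, v') \<in> A \<and> (w, w') \<in> B}"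

definition closed_tensor :: "('a, 'b) operator \<Rightarrow> ('c, 'd) operator \<Rightarrow> ('a \<times> 'c, 'b \<times> 'd) operator"
    (infixr \<open>\<otimes>\<^sub>o\<close> 70)
  where "A \<otimes>\<^sub>o B = closure (A \<odot> B)"


section \<open>Special functions\<close>

definition Iq :: "real \<Rightarrow> real set"
  where "Iq q = {- (q ^ n) | n :: nat. n \<ge> 1} \<union> {q powi k | k :: int. True}"

text \<open>On \<open>- q\<^sup>\<int> \<union> q\<^sup>\<int>\<close>, the only place where \<open>chi\<close> is used, the logarithm is an integer and the
  floor merely changes its type.\<close>

definition chi :: "real \<Rightarrow> real \<Rightarrow> int"
  where "chi q x = \<lfloor>log q \<bar>x\<bar>\<rfloor>"

definition nu :: "real \<Rightarrow> real \<Rightarrow> real"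
  where "nu q x = q powr (real_of_int ((chi q x - 1) * (chi q x - 2)) / 2)"

definition kappa :: "real \<Rightarrow> real"
  where "kappa x = sgn x * x\<^sup>2"

definition sxy :: "real \<Rightarrow> real \<Rightarrow> real"
  where "sxy x y = (if x > 0 \<and> y < 0 then -1 else 1)"

definition qpoch_inf :: "real \<Rightarrow> real \<Rightarrow> real"
  where "qpoch_inf a q = (\<Prod>k. 1 - a * q ^ k)"

text \<open>The quotient \<open>(a;q)\<^sub>\<infinity> / (aq\<^sup>n;q)\<^sub>\<infinity>\<close>, read as the finite product that it cancels to: for
  \<open>a = q\<^sup>-\<^sup>j\<close>, which does occur as the first argument of \<open>\<Psi>\<close> below, the quotient itself
  can be 0/0.\<close>

definition qpoch :: "real \<Rightarrow> real \<Rightarrow> nat \<Rightarrow> real"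
  where "qpoch a q n = (\<Prod>k<n. 1 - a * q ^ k)"

definition c_q :: "real \<Rightarrow> real"
  where "c_q q = inverse (sqrt 2 * q * (qpoch_inf (q\<^sup>2) (q\<^sup>2) * qpoch_inf (- (q\<^sup>2)) (q\<^sup>2)))"

definition \<Psi> :: "real \<Rightarrow> real \<Rightarrow> real \<Rightarrow> real \<Rightarrow> real"
  where "\<Psi> a b q z = (\<Sum>n. qpoch a q n * qpoch_inf (b * q ^ n) q / qpoch q q n *
    (-1) ^ n * q ^ (n * (n - 1) div 2) * z ^ n)"

definition a_fun :: "real \<Rightarrow> real \<Rightarrow> real \<Rightarrow> real \<Rightarrow> real"
  where "a_fun q p x y =
    (if sgn (x * y) \<noteq> sgn p then 0
     else c_q q * sxy x y * (-1) powi (chi q p) * (- sgn y) powi (chi q x) * \<bar>y\<bar> * nu q (p * y / x) *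
       sqrt (qpoch_inf (- kappa p) (q\<^sup>2) * qpoch_inf (- kappa y) (q\<^sup>2) / qpoch_inf (- kappa x) (q\<^sup>2)) *
       \<Psi> (- (q\<^sup>2) / kappa y) (q\<^sup>2 * kappa (x / y)) (q\<^sup>2) (q\<^sup>2 * kappa (x / p)))"


section \<open>The quantum group\<close>

text \<open>
  \<open>L\<^sup>2(\<T>)\<close> enters only through its orthonormal basis \<open>\<zeta>\<^sup>m\<close>, \<open>m \<in> \<int>\<close>; it is identified with
  \<open>\<ell>\<^sup>2(\<int>)\<close> by the Fourier transform. Hence \<open>L\<^sup>2(\<T>) \<otimes> \<ell>\<^sup>2(I\<^sub>q) \<otimes> \<ell>\<^sup>2(I\<^sub>q)\<close> is
  \<open>\<ell>\<^sup>2(\<int> \<times> I\<^sub>q \<times> I\<^sub>q)\<close>.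
\<close>

type_synonym lab = "int \<times> real \<times> real"

definition labels :: "real \<Rightarrow> lab set"
  where "labels q = UNIV \<times> Iq q \<times> Iq q"

definition \<K> :: "real \<Rightarrow> lab ell2 set"
  where "\<K> q = supported_on (labels q)"

definition \<K>\<K> :: "real \<Rightarrow> (lab \<times> lab) ell2 set"
  where "\<K>\<K> q = supported_on (labels q \<times> labels q)"

text \<open>The basis vector \<open>f\<^sub>m\<^sub>p\<^sub>t\<close>, read as \<open>0\<close> if \<open>p\<close> or \<open>t\<close> is outside \<open>I\<^sub>q\<close>.\<close>

definition fb :: "real \<Rightarrow> int \<Rightarrow> real \<Rightarrow> real \<Rightarrow> lab ell2"
  where "fb q m p t = (if p \<in> Iq q \<and> t \<in> Iq q then ket (m, p, t) else 0)"

text \<open>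
  The defining property of \<open>W\<close>. A unitary is determined by the values of its adjoint on an
  orthonormal basis, so at most one \<open>W\<close> satisfies this; the sum converges in norm,
  unconditionally.
\<close>

definition is_W :: "real \<Rightarrow> (lab \<times> lab, lab \<times> lab) operator \<Rightarrow> bool"
  where "is_W q W \<longleftrightarrow> unitary_on (\<K>\<K> q) W \<and>
    (\<forall>m1 m2. \<forall>p1\<in>Iq q. \<forall>t1\<in>Iq q. \<forall>p2\<in>Iq q. \<forall>t2\<in>Iq q.
      \<exists>\<psi>. (fb q m1 p1 t1 \<otimes>\<^sub>v fb q m2 p2 t2, \<psi>) \<in> adj (\<K>\<K> q) W \<and>
        ((\<lambda>(y, z). (\<bar>t2 / y\<bar> * a_fun q t2 p1 y *
              a_fun q p2 z (sgn (p2 * t2) * y * z * q powi m2 / p1)) *\<^sub>R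
            (fb q (m1 + m2 - chi q (p1 * p2 / (t2 * z))) z t1 \<otimes>\<^sub>v
             fb q (chi q (p1 * p2 / (t2 * z))) (sgn (p2 * t2) * y * z * q powi m2 / p1) y))
          has_sum \<psi>)
        {(y, z). y \<in> Iq q \<and> z \<in> Iq q \<and> sgn (p2 * t2) * y * z * q powi m2 / p1 \<in> Iq q})"

definition flip_op :: "real \<Rightarrow> (lab \<times> lab, lab \<times> lab) operator"
  where "flip_op q = {(\<psi>, \<phi>). \<psi> \<in> \<K>\<K> q \<and> (\<forall>i j. coord \<phi> (i, j) = coord \<psi> (j, i))}"

text \<open>\<open>\<Sigma> W (x \<otimes> 1) W\<^sup>* \<Sigma>\<close>; the formula is the same for elements of the dual von
  Neumann algebra and for operators affiliated to it, and makes sense for every operator \<open>x\<close>. The factors are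
  composed from right to left.\<close>

definition \<Delta>hat :: "real \<Rightarrow> (lab \<times> lab, lab \<times> lab) operator \<Rightarrow> (lab, lab) operator
    \<Rightarrow> (lab \<times> lab, lab \<times> lab) operator"
  where "\<Delta>hat q W x =
    flip_op q O adj (\<K>\<K> q) W O (x \<otimes>\<^sub>o Id_on (\<K> q)) O W O flip_op q"


section \<open>The operators\<close>

definition \<K>0 :: "real \<Rightarrow> lab ell2 set"
  where "\<K>0 q = cvec.span {fb q m p t | m p t. p \<in> Iq q \<and> t \<in> Iq q}"

text \<open>The graph of the linear map on \<open>\<K>0\<close> with given values on the basis is the span of the
  corresponding pairs.\<close>

definition K0 :: "real \<Rightarrow> (lab, lab) operator"
  where "K0 q = cgraph.span
    {(fb q m p t, (q powr (- real_of_int m / 2) * \<bar>p / t\<bar> powr (1/2)) *\<^sub>R fb q m p t)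
      | m p t. p \<in> Iq q \<and> t \<in> Iq q}"

definition E0 :: "real \<Rightarrow> (lab, lab) operator"
  where "E0 q = cgraph.span
    {(fb q m p t,
      inverse (q - inverse q) *\<^sub>R
        ((sgn t * q powr (- real_of_int (m - 1) / 2) * \<bar>p / t\<bar> powr (1/2) * sqrt (1 + kappa (t / q)))
            *\<^sub>R fb q (m - 1) p (t / q)
         - (sgn p * q powr (real_of_int (m - 1) / 2) * \<bar>t / p\<bar> powr (1/2) * sqrt (1 + kappa p))
            *\<^sub>R fb q (m - 1) (q * p) t))
      | m p t. p \<in> Iq q \<and> t \<in> Iq q}"

text \<open>The formal adjoint: the restriction of the adjoint to a map from \<open>\<K>0\<close> to \<open>\<K>0\<close>.\<close>

definition E0_dag :: "real \<Rightarrow> (lab, lab) operator"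
  where "E0_dag q = {(w, w'). w \<in> \<K>0 q \<and> w' \<in> \<K>0 q \<and>
    (\<forall>(v, v') \<in> E0 q. cinner v' w = cinner v w')}"

definition K_op :: "real \<Rightarrow> (lab, lab) operator"
  where "K_op q = closure (K0 q)"

definition E_op :: "real \<Rightarrow> (lab, lab) operator"
  where "E_op q = closure (E0 q)"

definition E_star :: "real \<Rightarrow> (lab, lab) operator"
  where "E_star q = adj (\<K> q) (E_op q)"

end

theory Submission
  imports Defs
begin

text \<open>
  Fix the second label \<open>j = (m, w, y)\<close> of the expansion of \<open>W\<^sup>*(f\<^sub>1 \<otimes> f\<^sub>2)\<close>. Only one \<open>z\<close>
  contributes, so this slice is a multiple of a single basis vector. Hence \<open>W\<^sup>*(f\<^sub>1 \<otimes> f\<^sub>2)\<close> is an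
  eigenvector of \<open>K \<otimes> 1\<close>, with the eigenvalue of \<open>f\<^sub>1 \<otimes> f\<^sub>2\<close> for \<open>K \<otimes> K\<close>; as both sides are
  multiplication operators up to a unitary, this gives the first claim. For \<open>E\<close>, truncating in \<open>j\<close>
  reduces membership in the closed operator \<open>E \<otimes> 1\<close> to an identity slice by slice. That identity has
  four terms, each a product of two values of \<open>a\<close>, and it is the sum of two three-term relations: one
  for \<open>a\<^bsub>t\<^sub>2\<^esub>(p\<^sub>1, y)\<close> and one for \<open>a\<^bsub>p\<^sub>2\<^esub>(z, w)\<close>, whose right-hand sides cancel. Both follow from
  contiguous relations for \<open>\<Psi>\<close>. The formal adjoint of \<open>E\<close> leads to the same two relations with their
  roles exchanged, so a sign \<open>e = \<plusminus>1\<close> covers both operators.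
\<close>

section \<open>Vectors and graphs of operators\<close>

text \<open>The obstacle is one of domains. \<open>W\<^sup>*(f\<^sub>1 \<otimes> f\<^sub>2)\<close>
  is an infinite sum, outside the algebraic domain of \<open>E \<otimes> 1\<close>, and applying
  \<open>E\<close> term by term would call for estimates on \<open>a\<^sub>p(x, y)\<close>. These
  are avoided: the candidate image is \<open>W\<^sup>*\<close> of a finite combination of basis
  vectors, hence square summable beforehand, so only coordinates have to be compared.

  The flip in the dual comultiplication exchanges the tensor legs, so the computation is made with
  \<open>E \<otimes> K + K\<inverse> \<otimes> E\<close>. On a slice, \<open>E \<otimes> 1\<close>
  shifts either \<open>t\<^sub>1\<close>, which \<open>W\<^sup>*\<close> merely carries along, or
  \<open>z\<close>. The first shift matches one term of the sum by counting exponents. Shifts of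
  \<open>p\<^sub>1\<close>, \<open>t\<^sub>2\<close> and \<open>p\<^sub>2\<close> all move
  \<open>z\<close> by the same power of \<open>q\<close>; together with the shift of
  \<open>z\<close> itself these are the four terms.

  The delicate place is the boundary of I_q: only -q has a neighbour, -1, outside it. The
  coefficient of that neighbour vanishes, but the three-term relations must survive without its
  term. This needs the zeros of \<open>\<Psi>\<close> at inverse powers of its base.\<close>

lemma coord_ket: "coord (ket j) i = (if i = j then 1 else 0)"
  by (simp add: ket.rep_eq)

lemma coord_tensor: "coord (v \<otimes>\<^sub>v w) (i, j) = coord v i * coord w j"
  by (simp add: tensor.rep_eq)

lemma ket_Pair: "ket (i, j) = ket i \<otimes>\<^sub>v ket j"
  by (rule ell2_eqI) (auto simp: coord_ket coord_tensor split: prod.splits if_splits)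

lemma norm_power2: "(norm v)\<^sup>2 = (\<Sum>\<^sub>\<infinity>i. (cmod (coord v i))\<^sup>2)"
  by (simp add: power2_norm_eq_inner inner_self)

lemma cmod_coord_le: "cmod (coord v i) \<le> norm v"
proof -
  have "(\<Sum>j\<in>{i}. (cmod (coord v j))\<^sup>2) \<le> (\<Sum>\<^sub>\<infinity>j. (cmod (coord v j))\<^sup>2)"
    by (rule finite_sum_le_infsum[OF coord_summable]) auto
  then show ?thesis
    by (intro power2_le_imp_le[OF _ norm_ge_zero]) (simp add: norm_power2)
qed

lemma bounded_linear_coord: "bounded_linear (\<lambda>v. coord v i)"
  by (rule bounded_linear_intro[of _ 1]) (simp_all add: coord_simps scaleR_conv_of_real cmod_coord_le)

lemma coord_sum: "coord (sum f A) i = (\<Sum>x\<in>A. coord (f x) i)"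
  by (rule linear_sum[OF bounded_linear.linear[OF bounded_linear_coord]])

lemma continuous_coord [continuous_intros]:
  "continuous_on S f \<Longrightarrow> continuous_on S (\<lambda>x. coord (f x) i)"
  by (rule bounded_linear.continuous_on[OF bounded_linear_coord])

lemma cinner_finite:
  assumes "finite A" "\<And>i. i \<notin> A \<Longrightarrow> coord v i = 0 \<or> coord w i = 0"
  shows "cinner v w = (\<Sum>i\<in>A. coord v i * cnj (coord w i))"
proof -
  have "cinner v w = (\<Sum>\<^sub>\<infinity>i\<in>A. coord v i * cnj (coord w i))"
    unfolding cinner_def by (rule infsum_cong_neutral) (use assms in auto)
  then show ?thesis using assms(1) by simp
qed

lemma cinner_ket_right: "cinner v (ket i) = coord v i"
  by (subst cinner_finite[of "{i}"]) (auto simp: coord_ket)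

lemma cinner_ket_left: "cinner (ket i) v = cnj (coord v i)"
  by (subst cinner_finite[of "{i}"]) (auto simp: coord_ket)

lemma cinner_add_right: "cinner u (v + w) = cinner u v + cinner u w"
  unfolding cinner_def
  by (simp add: coord_simps algebra_simps infsum_add[OF cinner_summable cinner_summable])

lemma cinner_scaleC_right: "cinner u (scaleC c v) = cnj c * cinner u v"
  unfolding cinner_def by (subst infsum_cmult_right'[symmetric]) (simp add: coord_simps mult_ac)

lemma cinner_zero_right: "cinner u 0 = 0"
  unfolding cinner_def by (simp add: coord_simps)

lemma cinner_diff_right: "cinner u (v - w) = cinner u v - cinner u w"
  using cinner_add_right[of u "v - w" w] by simp

lemma cinner_mult_left:
  assumes "\<And>i. coord w i \<noteq> 0 \<Longrightarrow> coord v' i = c * coord v i"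
  shows "cinner v' w = c * cinner v w"
  unfolding cinner_def
  by (subst infsum_cmult_right'[symmetric], rule infsum_cong) (use assms in \<open>auto simp: mult_ac\<close>)

lemma cinner_self_eq_0: "cinner v v = 0 \<Longrightarrow> v = 0"
  using inner_eq_zero_iff[of v] by (simp add: inner_ell2_def)

lemma scaleC_0: "scaleC 0 v = 0"
  by (auto intro!: ell2_eqI simp: coord_simps)

section \<open>Truncation of vectors to sets of labels, and spaces of vectors and graphs\<close>

lift_definition restr :: "'a set \<Rightarrow> 'a ell2 \<Rightarrow> 'a ell2"
  is "\<lambda>S f i. if i \<in> S then f i else 0"
  by (rule summable_on_comparison_test) (assumption | auto)+

lemma coord_restr: "coord (restr S v) i = (if i \<in> S then coord v i else 0)"
  by (simp add: restr.rep_eq)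

text \<open>The map \<open>g\<close> lets one lemma serve both truncations: the identity keeps
  finitely many coordinates, \<open>snd\<close> keeps finitely many whole slices. Once
  \<open>F\<close> contains the image under \<open>g\<close> of a finite set carrying all but
  \<open>e\<^sup>2\<close> of the squared norm, the error is below \<open>e\<close>.\<close>

lemma restr_tendsto:
  "((\<lambda>F. restr {i. g i \<in> F} v) \<longlongrightarrow> v) (finite_subsets_at_top UNIV)"
proof (rule tendstoI)
  fix e :: real assume e: "e > 0"
  define f where "f i = (cmod (coord v i))\<^sup>2" for i
  have f: "f summable_on UNIV" unfolding f_def by (rule coord_summable)
  have "\<forall>\<^sub>F F in finite_subsets_at_top UNIV. sum f F > infsum f UNIV - e\<^sup>2"
    using order_tendstoD(1)[OF infsum_tendsto[OF f], of "infsum f UNIV - e\<^sup>2"] e by simp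
  then obtain F0 where F0: "finite F0" "sum f F0 > infsum f UNIV - e\<^sup>2"
    unfolding eventually_finite_subsets_at_top by (metis order_refl)
  have "dist (restr {i. g i \<in> F} v) v < e" if "g ` F0 \<subseteq> F" for F
  proof -
    have "(norm (v - restr {i. g i \<in> F} v))\<^sup>2 = infsum f (- {i. g i \<in> F})"
      unfolding norm_power2 f_def
      by (rule infsum_cong_neutral) (auto simp: coord_simps coord_restr)
    also have "\<dots> \<le> infsum f (- F0)"
      using that by (intro infsum_mono2 summable_on_subset_banach[OF f]) (auto simp: f_def)
    also have "\<dots> = infsum f UNIV - infsum f F0"
      unfolding Compl_eq_Diff_UNIV using F0
      by (intro infsum_Diff f summable_on_finite) auto
    also have "\<dots> < e\<^sup>2" using F0 by simp
    finally show ?thesis using e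
      by (simp add: dist_norm norm_minus_commute power_less_imp_less_base)
  qed
  then show "\<forall>\<^sub>F F in finite_subsets_at_top UNIV. dist (restr {i. g i \<in> F} v) v < e"
    using F0(1) by (auto simp: eventually_finite_subsets_at_top intro!: exI[of _ "g ` F0"])
qed

lemma restr_pair_in_closure:
  assumes "\<And>F. finite F \<Longrightarrow> (restr {i. g i \<in> F} v, restr {i. h i \<in> F} v') \<in> A"
  shows "(v, v') \<in> closure A"
proof (rule Lim_in_closed_set[OF closed_closure _ _ tendsto_Pair[OF restr_tendsto restr_tendsto]])
  show "\<forall>\<^sub>F F in finite_subsets_at_top UNIV.
      (restr {i. g i \<in> F} v, restr {i. h i \<in> F} v') \<in> closure A"
    by (rule eventually_finite_subsets_at_top_weakI) (use assms closure_subset in blast)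
qed simp

lemma closed_supported_on: "closed (supported_on X)"
proof -
  have "supported_on X = (\<Inter>i\<in>-X. {v. coord v i = 0})"
    by (auto simp: supported_on_def)
  then show ?thesis
    by (auto intro!: closed_INT closed_Collect_eq continuous_intros)
qed

lemma ket_in_supported_on: "ket i \<in> supported_on X \<longleftrightarrow> i \<in> X"
  by (auto simp: supported_on_def coord_ket)

lemma scaleC_pair_simp: "scaleC_pair c (v, w) = (scaleC c v, scaleC c w)"
  by (simp add: scaleC_pair_def)

lemma sum_Pair: "(\<Sum>x\<in>A. (f x, g x)) = (sum f A, sum g A)"
  by (induction A rule: infinite_finite_induct) (auto simp: zero_prod_def)

lemma subspace_cgraphI:
  assumes "(0, 0) \<in> A"
    and "\<And>v v' w w'. (v, v') \<in> A \<Longrightarrow> (w, w') \<in> A \<Longrightarrow> (v + w, v' + w') \<in> A"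
    and "\<And>c v v'. (v, v') \<in> A \<Longrightarrow> (scaleC c v, scaleC c v') \<in> A"
  shows "cgraph.subspace A"
  using assms by (intro cgraph.subspaceI) (auto simp: scaleC_pair_simp zero_prod_def)

lemma subspace_cgraphD:
  assumes "cgraph.subspace A"
  shows "(0, 0) \<in> A"
    and "(v, v') \<in> A \<Longrightarrow> (w, w') \<in> A \<Longrightarrow> (v + w, v' + w') \<in> A"
    and "(v, v') \<in> A \<Longrightarrow> (scaleC c v, scaleC c v') \<in> A"
    and "(\<And>x. x \<in> X \<Longrightarrow> (f x, g x) \<in> A) \<Longrightarrow> (sum f X, sum g X) \<in> A"
  using cgraph.subspace_0[OF assms] cgraph.subspace_add[OF assms, of "(v, v')" "(w, w')"]
    cgraph.subspace_scale[OF assms, of "(v, v')" c]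
    cgraph.subspace_sum[OF assms, of X "\<lambda>x. (f x, g x)"]
  by (auto simp: scaleC_pair_simp zero_prod_def sum_Pair)

lemma norm_scaleC: "norm (scaleC c v) = cmod c * norm v"
proof (rule power2_eq_imp_eq)
  show "(norm (scaleC c v))\<^sup>2 = (cmod c * norm v)\<^sup>2"
    by (simp add: norm_power2 power_mult_distrib coord_simps norm_mult infsum_cmult_right')
qed simp_all

lemma bounded_linear_scaleC: "bounded_linear (scaleC c)"
  by (rule bounded_linear_intro[of _ "cmod c"])
    (auto intro!: ell2_eqI simp: coord_simps algebra_simps norm_scaleC)

lemma subspace_closure:
  fixes A :: "('a ell2 \<times> 'b ell2) set"
  assumes A: "cgraph.subspace A"
  shows "cgraph.subspace (closure A)"
proof (rule cgraph.subspaceI)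
  show "0 \<in> closure A"
    using cgraph.subspace_0[OF A] closure_subset by blast
next
  fix x y assume xy: "x \<in> closure A" "y \<in> closure A"
  then obtain f g where "\<And>n. f n \<in> A" "f \<longlonglongrightarrow> x" "\<And>n. g n \<in> A" "g \<longlonglongrightarrow> y"
    unfolding closure_sequential by metis
  then show "x + y \<in> closure A"
    unfolding closure_sequential
    by (intro exI[of _ "\<lambda>n. f n + g n"]) (auto intro: tendsto_add cgraph.subspace_add[OF A])
next
  fix c x assume "x \<in> closure A"
  then obtain f where f: "\<And>n. f n \<in> A" "f \<longlonglongrightarrow> x"
    unfolding closure_sequential by metis
  have "(\<lambda>n. (scaleC c (fst (f n)), scaleC c (snd (f n)))) \<longlonglongrightarrow> (scaleC c (fst x), scaleC c (snd x))"
    by (intro tendsto_Pair bounded_linear.tendsto[OF bounded_linear_scaleC] tendsto_fst tendsto_snd f)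
  then have "(\<lambda>n. scaleC_pair c (f n)) \<longlonglongrightarrow> scaleC_pair c x"
    by (simp add: scaleC_pair_def map_prod_def split_beta)
  then show "scaleC_pair c x \<in> closure A"
    unfolding closure_sequential using cgraph.subspace_scale[OF A f(1)]
    by (intro exI[of _ "\<lambda>n. scaleC_pair c (f n)"] conjI allI)
qed

lemma subspace_relcomp:
  assumes "cgraph.subspace A" "cgraph.subspace B"
  shows "cgraph.subspace (A O B)"
proof (rule subspace_cgraphI)
  note D = assms[THEN subspace_cgraphD(1)] assms[THEN subspace_cgraphD(2)]
    assms[THEN subspace_cgraphD(3)]
  show "(0, 0) \<in> A O B" by (rule relcompI[OF D(1,2)])
  show "(v + w, v' + w') \<in> A O B" if "(v, v') \<in> A O B" "(w, w') \<in> A O B" for v v' w w'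
    using that by (elim relcompE Pair_inject) (simp, rule relcompI, (rule D, assumption+)+)
  show "(scaleC c v, scaleC c v') \<in> A O B" if "(v, v') \<in> A O B" for c v v'
    using that by (elim relcompE Pair_inject) (simp, rule relcompI, (rule D, assumption+)+)
qed

lemma subspace_adj: 
  assumes "cvec.subspace H"
  shows "cgraph.subspace (adj H A)"
  using cvec.subspace_0[OF assms] cvec.subspace_add[OF assms] cvec.subspace_scale[OF assms]
  by (intro subspace_cgraphI)
    (fastforce simp: adj_def cinner_zero_right cinner_add_right cinner_scaleC_right)+

lemma subspace_supported_on: "cvec.subspace (supported_on X)"
  by (rule cvec.subspaceI) (auto simp: supported_on_def coord_simps)

section \<open>Operators given on basis vectors\<close>

text \<open>The domain is the set of finitely supported vectors on \<open>X\<close>. As the graph is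
  a span, its inclusion in another linear relation has to be checked on the vectors
  \<open>ket x\<close> only.\<close>

definition basis_op :: "'a set \<Rightarrow> ('a \<Rightarrow> 'b ell2) \<Rightarrow> ('a, 'b) operator"
  where "basis_op X F = cgraph.span {(ket x, F x) | x. x \<in> X}"

lemma subspace_basis_op: "cgraph.subspace (basis_op X F)"
  unfolding basis_op_def by (rule cgraph.subspace_span)

lemma basis_op_base: "x \<in> X \<Longrightarrow> (ket x, F x) \<in> basis_op X F"
  unfolding basis_op_def by (rule cgraph.span_base) blast

lemma basis_op_minimal:
  "cgraph.subspace A \<Longrightarrow> (\<And>x. x \<in> X \<Longrightarrow> (ket x, F x) \<in> A) \<Longrightarrow> basis_op X F \<subseteq> A"
  unfolding basis_op_def by (rule cgraph.span_minimal) auto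

lemma basis_opE:
  assumes "(v, a) \<in> basis_op X F"
  obtains A where "finite A" "A \<subseteq> X" "\<And>x. x \<notin> A \<Longrightarrow> coord v x = 0"
    "a = (\<Sum>x\<in>A. scaleC (coord v x) (F x))"
proof -
  \<comment> \<open>\<open>A\<close> is any finite set containing the support rather than the
    support itself, so that two witnesses can be merged into their union.\<close>
  define P where "P = {(v, a). \<exists>A. finite A \<and> A \<subseteq> X \<and> (\<forall>x. x \<notin> A \<longrightarrow> coord v x = 0) \<and>
    a = (\<Sum>x\<in>A. scaleC (coord v x) (F x))}"
  have "basis_op X F \<subseteq> P"
  proof (rule basis_op_minimal[OF subspace_cgraphI])
    show "(0, 0) \<in> P" unfolding P_def by (auto intro!: exI[of _ "{}"] simp: coord_simps)
  next
    fix v v' w w' assume "(v, v') \<in> P" "(w, w') \<in> P"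
    then obtain A B where A: "finite A" "A \<subseteq> X" "\<forall>x. x \<notin> A \<longrightarrow> coord v x = 0"
      "v' = (\<Sum>x\<in>A. scaleC (coord v x) (F x))"
      and B: "finite B" "B \<subseteq> X" "\<forall>x. x \<notin> B \<longrightarrow> coord w x = 0"
      "w' = (\<Sum>x\<in>B. scaleC (coord w x) (F x))" unfolding P_def by blast
    have "v' = (\<Sum>x\<in>A\<union>B. scaleC (coord v x) (F x))"
      unfolding A(4) by (rule sum.mono_neutral_left) (use A(1,3) B(1) in \<open>auto simp: scaleC_0\<close>)
    moreover have "w' = (\<Sum>x\<in>A\<union>B. scaleC (coord w x) (F x))"
      unfolding B(4) by (rule sum.mono_neutral_left) (use B(1,3) A(1) in \<open>auto simp: scaleC_0\<close>)
    ultimately have "v' + w' = (\<Sum>x\<in>A\<union>B. scaleC (coord (v + w) x) (F x))"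
      by (simp add: coord_simps sum.distrib cvec.scale_left_distrib)
    moreover have "finite (A \<union> B)" "A \<union> B \<subseteq> X" "\<forall>x. x \<notin> A \<union> B \<longrightarrow> coord (v + w) x = 0"
      using A(1-3) B(1-3) by (auto simp: coord_simps)
    ultimately show "(v + w, v' + w') \<in> P" unfolding P_def by blast
  next
    fix c v v' assume "(v, v') \<in> P"
    then obtain A where A: "finite A" "A \<subseteq> X" "\<forall>x. x \<notin> A \<longrightarrow> coord v x = 0"
      "v' = (\<Sum>x\<in>A. scaleC (coord v x) (F x))" unfolding P_def by blast
    then show "(scaleC c v, scaleC c v') \<in> P" unfolding P_def
      by (auto intro!: exI[of _ A] simp: coord_simps cvec.scale_sum_right)
  next
    fix x assume "x \<in> X"
    then show "(ket x, F x) \<in> P" unfolding P_def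
      by (auto intro!: exI[of _ "{x}"] simp: coord_ket)
  qed
  then show ?thesis using assms that unfolding P_def by blast
qed

lemma basis_opI:
  assumes "finite A" "A \<subseteq> X" "\<And>x. x \<notin> A \<Longrightarrow> coord v x = 0"
  shows "(v, \<Sum>x\<in>A. scaleC (coord v x) (F x)) \<in> basis_op X F"
proof -
  have v: "(\<Sum>x\<in>A. scaleC (coord v x) (ket x)) = v"
    using assms by (auto intro!: ell2_eqI simp: coord_sum coord_simps coord_ket if_distrib cong: if_cong)
  have "(\<Sum>x\<in>A. scaleC (coord v x) (ket x), \<Sum>x\<in>A. scaleC (coord v x) (F x)) \<in> basis_op X F"
    using assms(2)
    by (intro subspace_cgraphD(3,4)[OF subspace_basis_op] basis_op_base) auto
  then show ?thesis by (simp only: v)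
qed

lemma basis_op_plus: "basis_op X F +\<^sub>o basis_op X G \<subseteq> basis_op X (\<lambda>x. F x + G x)"
proof (clarsimp simp: op_plus_def)
  fix v a b assume v: "(v, a) \<in> basis_op X F" "(v, b) \<in> basis_op X G"
  obtain A where A: "finite A" "A \<subseteq> X" "\<And>x. x \<notin> A \<Longrightarrow> coord v x = 0"
    "a = (\<Sum>x\<in>A. scaleC (coord v x) (F x))" using basis_opE[OF v(1)] by blast
  obtain B where B: "finite B" "B \<subseteq> X" "\<And>x. x \<notin> B \<Longrightarrow> coord v x = 0"
    "b = (\<Sum>x\<in>B. scaleC (coord v x) (G x))" using basis_opE[OF v(2)] by blast
  have "a = (\<Sum>x\<in>A\<union>B. scaleC (coord v x) (F x))"
    unfolding A(4) by (rule sum.mono_neutral_left) (use A(1,3) B(1) in \<open>auto simp: scaleC_0\<close>)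
  moreover have "b = (\<Sum>x\<in>A\<union>B. scaleC (coord v x) (G x))"
    unfolding B(4) by (rule sum.mono_neutral_left) (use B(1,3) A(1) in \<open>auto simp: scaleC_0\<close>)
  ultimately have "a + b = (\<Sum>x\<in>A\<union>B. scaleC (coord v x) (F x + G x))"
    by (simp add: sum.distrib cvec.scale_right_distrib)
  then show "(v, a + b) \<in> basis_op X (\<lambda>x. F x + G x)"
    using basis_opI[of "A \<union> B" X v "\<lambda>x. F x + G x"] A B by auto
qed

section \<open>Tensor products of operators\<close>

lemma tensor_add_left: "(u + v) \<otimes>\<^sub>v w = u \<otimes>\<^sub>v w + v \<otimes>\<^sub>v w"
  and tensor_add_right: "w \<otimes>\<^sub>v (u + v) = w \<otimes>\<^sub>v u + w \<otimes>\<^sub>v v"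
  and tensor_scaleC_left: "scaleC c v \<otimes>\<^sub>v w = scaleC c (v \<otimes>\<^sub>v w)"
  and tensor_scaleC_right: "w \<otimes>\<^sub>v scaleC c v = scaleC c (w \<otimes>\<^sub>v v)"
  and tensor_zero_left: "0 \<otimes>\<^sub>v w = 0"
  and tensor_zero_right: "w \<otimes>\<^sub>v 0 = 0"
  for u v :: "'a ell2" and w :: "'b ell2"
  by (auto intro!: ell2_eqI simp: coord_tensor coord_simps algebra_simps)

text \<open>Minimality of the span is used once per leg: on the right with \<open>ket x\<close>
  fixed on the left, then on the left with an arbitrary pair \<open>(w, w')\<close> fixed on the
  right.\<close>

lemma alg_tensor_basis_op:
  "basis_op X F \<odot> basis_op Y G \<subseteq> basis_op (X \<times> Y) (\<lambda>(x, y). F x \<otimes>\<^sub>v G y)" (is "_ \<subseteq> ?R")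
  unfolding alg_tensor_def
proof (rule cgraph.span_minimal[OF _ subspace_basis_op], clarify)
  note R = subspace_cgraphD[OF subspace_basis_op[of "X \<times> Y" "\<lambda>(x, y). F x \<otimes>\<^sub>v G y"]]
  fix v v' w w' assume v: "(v, v') \<in> basis_op X F" and w: "(w, w') \<in> basis_op Y G"
  have *: "(ket x \<otimes>\<^sub>v w, F x \<otimes>\<^sub>v w') \<in> ?R" if "x \<in> X" for x
  proof -
    have "basis_op Y G \<subseteq> {(w, w'). (ket x \<otimes>\<^sub>v w, F x \<otimes>\<^sub>v w') \<in> ?R}"
      using basis_op_base[of "(x, _)" "X \<times> Y" "\<lambda>(x, y). F x \<otimes>\<^sub>v G y"] that R
      by (intro basis_op_minimal subspace_cgraphI)
        (auto simp: tensor_add_right tensor_scaleC_right tensor_zero_right ket_Pair)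
    then show ?thesis using w by blast
  qed
  have "basis_op X F \<subseteq> {(v, v'). (v \<otimes>\<^sub>v w, v' \<otimes>\<^sub>v w') \<in> ?R}"
    using * R
    by (intro basis_op_minimal subspace_cgraphI)
      (auto simp: tensor_add_left tensor_scaleC_left tensor_zero_left)
  then show "(v \<otimes>\<^sub>v w, v' \<otimes>\<^sub>v w') \<in> ?R" using v by blast
qed

lemma alg_tensor_mono: "A \<subseteq> A' \<Longrightarrow> B \<subseteq> B' \<Longrightarrow> A \<odot> B \<subseteq> A' \<odot> B'"
  unfolding alg_tensor_def by (rule cgraph.span_mono) blast

lemma op_plus_mono: "A \<subseteq> A' \<Longrightarrow> B \<subseteq> B' \<Longrightarrow> A +\<^sub>o B \<subseteq> A' +\<^sub>o B'"
  unfolding op_plus_def by blast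

lemma subspace_closed_tensor: "cgraph.subspace (A \<otimes>\<^sub>o B)"
  unfolding closed_tensor_def alg_tensor_def
  by (rule subspace_closure[OF cgraph.subspace_span])

text \<open>Cutting down to finitely many second labels leaves a finite sum of terms
  \<open>v j \<otimes>\<^sub>v ket j\<close>, on which \<open>A \<odot> 1\<close> is defined. Both
  truncations converge because \<open>\<psi>\<close> and \<open>\<phi>\<close> are given as vectors,
  so no bound on \<open>A\<close> enters.\<close>

lemma closed_tensor_Id_slices:
  fixes A :: "('a, 'a) operator" and Y :: "'b set"
  assumes "\<And>j. \<exists>v v'. (v, v') \<in> A \<and> (\<forall>i. coord \<psi> (i, j) = coord v i \<and> coord \<phi> (i, j) = coord v' i)"
    and "\<psi> \<in> supported_on (X \<times> Y)" "\<phi> \<in> supported_on (X \<times> Y)"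
  shows "(\<psi>, \<phi>) \<in> A \<otimes>\<^sub>o Id_on (supported_on Y)"
  unfolding closed_tensor_def
proof (rule restr_pair_in_closure)
  fix F :: "'b set" assume F: "finite F"
  obtain v v' where v: "\<And>j. (v j, v' j) \<in> A" "\<And>i j. coord \<psi> (i, j) = coord (v j) i"
    "\<And>i j. coord \<phi> (i, j) = coord (v' j) i"
    using assms(1) by metis
  \<comment> \<open>Labels outside \<open>Y\<close> are dropped since \<open>ket j\<close> is then
    outside the domain of \<open>Id_on (supported_on Y)\<close>; the support hypotheses make those
    slices zero.\<close>
  have "restr {i. snd i \<in> F} \<psi> = (\<Sum>j\<in>F \<inter> Y. v j \<otimes>\<^sub>v ket j)"
    "restr {i. snd i \<in> F} \<phi> = (\<Sum>j\<in>F \<inter> Y. v' j \<otimes>\<^sub>v ket j)"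
    using F assms(2,3) v(2,3)
    by (auto intro!: ell2_eqI simp: coord_sum coord_tensor coord_ket coord_restr supported_on_def
        if_distrib[of "(*) _"] cong: if_cong)
  moreover have "(v j \<otimes>\<^sub>v ket j, v' j \<otimes>\<^sub>v ket j) \<in> A \<odot> Id_on (supported_on Y)" if "j \<in> F \<inter> Y" for j
    unfolding alg_tensor_def using that v(1)[of j]
    by (intro cgraph.span_base) (force simp: ket_in_supported_on Id_on_iff)
  ultimately show "(restr {i. snd i \<in> F} \<psi>, restr {i. snd i \<in> F} \<phi>) \<in> A \<odot> Id_on (supported_on Y)"
    unfolding alg_tensor_def by (simp only:) (rule subspace_cgraphD(4)[OF cgraph.subspace_span], blast)
qed

section \<open>Multiplication operators\<close>

text \<open>The maximal, possibly unbounded multiplication operator: square summability of the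
  product is encoded by the existence of the vector \<open>v'\<close>.\<close>

definition mult_op :: "'a set \<Rightarrow> ('a \<Rightarrow> complex) \<Rightarrow> ('a, 'a) operator"
  where "mult_op X k = {(v, v'). v \<in> supported_on X \<and> v' \<in> supported_on X \<and>
    (\<forall>i. coord v' i = k i * coord v i)}"

lemma subspace_mult_op: "cgraph.subspace (mult_op X k)"
  by (rule subspace_cgraphI)
    (auto simp: mult_op_def supported_on_def coord_simps algebra_simps)

lemma closed_mult_op: "closed (mult_op X k)"
proof -
  have "mult_op X k = (supported_on X \<times> supported_on X) \<inter>
      (\<Inter>i. {x. coord (snd x) i = k i * coord (fst x) i})"
    by (auto simp: mult_op_def)
  then show ?thesis
    by (auto intro!: closed_Int closed_Times closed_supported_on closed_INT closed_Collect_eq continuous_intros)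
qed

text \<open>Truncation commutes with multiplication, so the finitely supported vectors form a
  core.\<close>

lemma closure_basis_op_scale:
  "closure (basis_op X (\<lambda>x. scaleC (k x) (ket x))) = mult_op X k"
proof (rule antisym)
  show "closure (basis_op X (\<lambda>x. scaleC (k x) (ket x))) \<subseteq> mult_op X k"
    by (intro closure_minimal closed_mult_op basis_op_minimal subspace_mult_op)
      (auto simp: mult_op_def supported_on_def coord_simps coord_ket)
  show "mult_op X k \<subseteq> closure (basis_op X (\<lambda>x. scaleC (k x) (ket x)))"
  proof (clarify, rule restr_pair_in_closure)
    fix v v' F assume v: "(v, v') \<in> mult_op X k" and F: "finite (F :: 'a set)"
    have "(restr F v, \<Sum>x\<in>F \<inter> X. scaleC (coord (restr F v) x) (scaleC (k x) (ket x)))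
        \<in> basis_op X (\<lambda>x. scaleC (k x) (ket x))"
      using v F by (intro basis_opI) (auto simp: mult_op_def supported_on_def coord_restr)
    also have "(\<Sum>x\<in>F \<inter> X. scaleC (coord (restr F v) x) (scaleC (k x) (ket x))) = restr F v'"
      using v F
      by (auto intro!: ell2_eqI simp: coord_sum coord_simps coord_ket coord_restr mult_op_def
          supported_on_def if_distrib[of "(*) _"] cong: if_cong)
    finally show "(restr {i. i \<in> F} v, restr {i. i \<in> F} v')
        \<in> basis_op X (\<lambda>x. scaleC (k x) (ket x))" by simp
  qed
qed

text \<open>For the inclusion from right to left the right side is the closure of its restriction to
  finitely supported vectors, and each \<open>ket (x, y)\<close> is an elementary tensor of
  eigenvectors.\<close>

lemma mult_op_tensor:
  "mult_op X k \<otimes>\<^sub>o mult_op Y h = mult_op (X \<times> Y) (\<lambda>(x, y). k x * h y)"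
  unfolding closed_tensor_def
proof (rule antisym)
  show "closure (mult_op X k \<odot> mult_op Y h) \<subseteq> mult_op (X \<times> Y) (\<lambda>(x, y). k x * h y)"
    unfolding alg_tensor_def
    by (intro closure_minimal closed_mult_op cgraph.span_minimal subspace_mult_op)
      (auto simp: mult_op_def supported_on_def coord_tensor)
  have "basis_op (X \<times> Y) (\<lambda>x. scaleC ((\<lambda>(x, y). k x * h y) x) (ket x)) \<subseteq> mult_op X k \<odot> mult_op Y h"
  proof (rule basis_op_minimal)
    fix z assume "z \<in> X \<times> Y"
    then obtain x y where z: "z = (x, y)" "x \<in> X" "y \<in> Y" by auto
    have "(ket x, scaleC (k x) (ket x)) \<in> mult_op X k" "(ket y, scaleC (h y) (ket y)) \<in> mult_op Y h"
      using z by (auto simp: mult_op_def supported_on_def coord_simps coord_ket)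
    moreover have "scaleC ((\<lambda>(x, y). k x * h y) z) (ket z)
        = scaleC (k x) (ket x) \<otimes>\<^sub>v scaleC (h y) (ket y)"
      by (auto intro!: ell2_eqI simp: z coord_simps coord_ket coord_tensor)
    moreover have "ket z = ket x \<otimes>\<^sub>v ket y" by (simp add: z ket_Pair)
    ultimately show "(ket z, scaleC ((\<lambda>(x, y). k x * h y) z) (ket z)) \<in> mult_op X k \<odot> mult_op Y h"
      unfolding alg_tensor_def by (intro cgraph.span_base) auto
  qed (simp add: alg_tensor_def)
  then show "mult_op (X \<times> Y) (\<lambda>(x, y). k x * h y) \<subseteq> closure (mult_op X k \<odot> mult_op Y h)"
    using closure_mono closure_basis_op_scale[of "X \<times> Y" "\<lambda>(x, y). k x * h y"] by blast
qed

lemma Id_on_supported_on: "Id_on (supported_on X) = mult_op X (\<lambda>_. 1)"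
proof -
  have "v' = v \<longleftrightarrow> (\<forall>i. coord v' i = coord v i)" for v v' :: "'a ell2"
    by (auto intro: ell2_eqI)
  then show ?thesis by (auto simp: mult_op_def Id_on_iff)
qed

lemma adj_unitary_on:
  assumes U: "unitary_on (supported_on X) U"
  shows "adj (supported_on X) U = U\<inverse>"
proof (rule set_eqI, clarify, rule iffI)
  fix w w' assume "(w, w') \<in> adj (supported_on X) U"
  then have w: "w \<in> supported_on X" "w' \<in> supported_on X"
    "\<And>v v'. (v, v') \<in> U \<Longrightarrow> cinner v' w = cinner v w'" by (auto simp: adj_def)
  obtain u where u: "(u, w) \<in> U" using w(1) U by (metis unitary_on_def Range_iff)
  then have "u \<in> supported_on X" using U by (auto simp: unitary_on_def)
  then have "u - w' \<in> supported_on X" using w(2) by (auto simp: supported_on_def coord_simps)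
  \<comment> \<open>Isometry and the adjoint relation evaluate \<open>cinner x w\<close> in two
    ways; the difference of the two values is the squared norm of \<open>u - w'\<close>.\<close>
  then obtain x where x: "(u - w', x) \<in> U" using U by (metis unitary_on_def Domain_iff)
  have "cinner x w = cinner (u - w') u" using U x u by (force simp: unitary_on_def)
  moreover have "cinner x w = cinner (u - w') w'" by (rule w(3)[OF x])
  ultimately have "u - w' = 0" by (intro cinner_self_eq_0) (simp add: cinner_diff_right)
  then show "(w, w') \<in> U\<inverse>" using u by simp
next
  fix w w' assume "(w, w') \<in> U\<inverse>"
  then show "(w, w') \<in> adj (supported_on X) U" using U by (fastforce simp: unitary_on_def adj_def)
qed

lemma unitary_on_cinner:
  "unitary_on H U \<Longrightarrow> (v, v') \<in> U \<Longrightarrow> (w, w') \<in> U \<Longrightarrow> cinner v' w' = cinner v w"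
  unfolding unitary_on_def by blast

section \<open>Contiguous relations for \<open>\<Psi>\<close>\<close>

context
  fixes q :: real
  assumes q: "0 < q" "q < 1"
begin

lemma qpoch_tendsto: "qpoch a q \<longlonglongrightarrow> qpoch_inf a q"
proof -
  have "summable (\<lambda>k. \<bar>a\<bar> * q ^ k)"
    using q by (intro summable_mult summable_geometric) auto
  then have "abs_convergent_prod (\<lambda>k. 1 - a * q ^ k)"
    using q by (simp add: abs_convergent_prod_conv_summable abs_mult power_abs)
  then show ?thesis
    using convergent_prod_LIMSEQ[OF abs_convergent_prod_imp_convergent_prod]
    by (simp add: qpoch_def[abs_def] qpoch_inf_def LIMSEQ_lessThan_iff_atMost[of "prod _"])
qed

lemma qpoch_inf_rec: "qpoch_inf a q = (1 - a) * qpoch_inf (a * q) q"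
proof -
  have "qpoch a q (Suc n) = (1 - a) * qpoch (a * q) q n" for n
    by (simp add: qpoch_def prod.lessThan_Suc_shift mult_ac del: prod.lessThan_Suc)
  then have "(\<lambda>n. qpoch a q (Suc n)) \<longlonglongrightarrow> (1 - a) * qpoch_inf (a * q) q"
    using tendsto_mult_left[OF qpoch_tendsto] by simp
  then show ?thesis
    using LIMSEQ_unique LIMSEQ_Suc[OF qpoch_tendsto] by blast
qed

lemma qpoch_mult_inf: "qpoch a q n * qpoch_inf (a * q ^ n) q = qpoch_inf a q"
proof (induction n)
  case (Suc n)
  then show ?case
    using qpoch_inf_rec[of "a * q ^ n"] by (simp add: qpoch_def mult_ac)
qed (simp add: qpoch_def)

lemma qpoch_inf_inverse_power: "qpoch_inf (inverse (q ^ k)) q = 0"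
proof (induction k)
  case 0
  then show ?case using qpoch_inf_rec[of 1] by simp
next
  case (Suc k)
  moreover have "inverse (q ^ Suc k) * q = inverse (q ^ k)" using q by (simp add: field_simps)
  ultimately show ?case using qpoch_inf_rec[of "inverse (q ^ Suc k)"] by (simp del: power_Suc)
qed

lemma abs_qpoch_le: "\<bar>qpoch a q n\<bar> \<le> exp (\<bar>a\<bar> / (1 - q))"
proof -
  have "\<bar>qpoch a q n\<bar> \<le> (\<Prod>k<n. exp (\<bar>a\<bar> * q ^ k))"
    unfolding qpoch_def abs_prod
  proof (intro prod_mono conjI abs_ge_zero)
    fix k
    have "\<bar>1 - a * q ^ k\<bar> \<le> 1 + \<bar>a * q ^ k\<bar>" by linarith
    also have "\<dots> \<le> exp (\<bar>a\<bar> * q ^ k)"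
      using exp_ge_add_one_self[of "\<bar>a\<bar> * q ^ k"] q by (simp add: abs_mult)
    finally show "\<bar>1 - a * q ^ k\<bar> \<le> exp (\<bar>a\<bar> * q ^ k)" .
  qed
  also have "\<dots> = exp (\<bar>a\<bar> * (\<Sum>k<n. q ^ k))"
    by (simp add: exp_sum sum_distrib_left)
  also have "(\<Sum>k<n. q ^ k) \<le> 1 / (1 - q)"
    using q by (simp add: sum_gp_strict divide_right_mono)
  then have "exp (\<bar>a\<bar> * (\<Sum>k<n. q ^ k)) \<le> exp (\<bar>a\<bar> / (1 - q))"
    using mult_left_mono[of _ _ "\<bar>a\<bar>"] by fastforce
  finally show ?thesis .
qed

lemma abs_qpoch_inf_le: "\<bar>qpoch_inf a q\<bar> \<le> exp (\<bar>a\<bar> / (1 - q))"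
  by (rule LIMSEQ_le_const2[OF tendsto_rabs[OF qpoch_tendsto]]) (use abs_qpoch_le in blast)

text \<open>A geometric lower bound for the denominators of \<open>\<Psi>\<close> is enough, since
  the Gaussian factor \<open>q ^ (n * (n - 1) div 2)\<close> beats any geometric growth.\<close>

lemma qpoch_self_ge: "(1 - q) ^ n \<le> qpoch q q n"
proof -
  have "q * q ^ k \<le> q" for k
    using mult_left_mono[OF power_le_one[of q k], of q] q by simp
  then show ?thesis
    unfolding qpoch_def prod_constant[of _ "{..<n}", simplified card_lessThan, symmetric]
    by (intro prod_mono) (use q in auto)
qed

lemma triangle_Suc: "Suc n * n div 2 = n * (n - 1) div 2 + n"
proof (cases n)
  case (Suc m)
  have "Suc n * n = n * (n - 1) + 2 * n" by (simp add: Suc algebra_simps)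
  then show ?thesis by (metis div_mult_self4 zero_neq_numeral add.commute)
qed simp

lemma summable_triangle_power: "summable (\<lambda>n. q ^ (n * (n - 1) div 2) * r ^ n)" if "r \<ge> 0" for r :: real
proof -
  have "(\<lambda>n. q ^ n * r) \<longlonglongrightarrow> 0 * r"
    using q by (intro tendsto_mult_right LIMSEQ_realpow_zero) auto
  then have "\<forall>\<^sub>F n in sequentially. q ^ n * r < 1 / 2"
    by (rule order_tendstoD(2)) simp
  then obtain N where N: "\<And>n. n \<ge> N \<Longrightarrow> q ^ n * r \<le> 1 / 2"
    unfolding eventually_sequentially by (meson less_imp_le)
  show ?thesis
  proof (rule summable_ratio_test[of "1 / 2" N])
    fix n assume "n \<ge> N"
    then have "(q ^ n * r) * (q ^ (n * (n - 1) div 2) * r ^ n)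
        \<le> 1 / 2 * (q ^ (n * (n - 1) div 2) * r ^ n)"
      using N q that by (intro mult_right_mono) auto
    moreover have "q ^ (Suc n * (Suc n - 1) div 2) * r ^ Suc n
        = (q ^ n * r) * (q ^ (n * (n - 1) div 2) * r ^ n)"
      using arg_cong[OF triangle_Suc[of n], of "(^) q"] by (simp add: power_add del: mult_Suc)
    ultimately have "q ^ (Suc n * (Suc n - 1) div 2) * r ^ Suc n
        \<le> 1 / 2 * (q ^ (n * (n - 1) div 2) * r ^ n)" by (simp only:)
    moreover have "0 \<le> q ^ i * r ^ j" for i j using q that by simp
    ultimately show "norm (q ^ (Suc n * (Suc n - 1) div 2) * r ^ Suc n)
        \<le> 1 / 2 * norm (q ^ (n * (n - 1) div 2) * r ^ n)"
      by (simp only: real_norm_def abs_of_nonneg)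
  qed simp
qed

section \<open>The series \<open>\<Psi>\<close> and its shifts in \<open>b\<close> and
  \<open>z\<close>\<close>

definition \<Psi>_term :: "real \<Rightarrow> real \<Rightarrow> real \<Rightarrow> nat \<Rightarrow> real"
  where "\<Psi>_term a b z n = qpoch a q n * qpoch_inf (b * q ^ n) q / qpoch q q n *
    (-1) ^ n * q ^ (n * (n - 1) div 2) * z ^ n"

text \<open>The numerators are bounded uniformly in \<open>n\<close> and the denominators are at
  least \<open>(1 - q) ^ n\<close>, which leaves a Gaussian series with ratio
  \<open>\<bar>z\<bar> / (1 - q)\<close>. Hence the arguments are unrestricted.\<close>

lemma \<Psi>_sums: "\<Psi>_term a b z sums \<Psi> a b q z"
proof -
  define C where "C = exp (\<bar>a\<bar> / (1 - q)) * exp (\<bar>b\<bar> / (1 - q))"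
  have "norm (\<Psi>_term a b z n) \<le> C * (q ^ (n * (n - 1) div 2) * (\<bar>z\<bar> / (1 - q)) ^ n)" for n
  proof -
    have "\<bar>b\<bar> * q ^ n \<le> \<bar>b\<bar>"
      using mult_left_mono[OF power_le_one[of q n], of "\<bar>b\<bar>"] q by simp
    then have "\<bar>b * q ^ n\<bar> \<le> \<bar>b\<bar>" using q by (simp add: abs_mult power_abs)
    then have "\<bar>b * q ^ n\<bar> / (1 - q) \<le> \<bar>b\<bar> / (1 - q)"
      by (rule divide_right_mono) (use q in simp)
    then have e: "exp (\<bar>b * q ^ n\<bar> / (1 - q)) \<le> exp (\<bar>b\<bar> / (1 - q))"
      by (simp only: exp_le_cancel_iff)
    have "\<bar>qpoch a q n * qpoch_inf (b * q ^ n) q\<bar> \<le> C"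
      unfolding C_def abs_mult[of "qpoch a q n"]
      by (intro mult_mono abs_qpoch_le order_trans[OF abs_qpoch_inf_le e]) auto
    moreover have "0 < (1 - q) ^ n" using q by simp
    ultimately have "\<bar>qpoch a q n * qpoch_inf (b * q ^ n) q\<bar> / qpoch q q n \<le> C / (1 - q) ^ n"
      using qpoch_self_ge[of n] by (intro frac_le) auto
    moreover have "qpoch q q n > 0" using qpoch_self_ge[of n] \<open>0 < (1 - q) ^ n\<close> by linarith
    ultimately have "\<bar>qpoch a q n * qpoch_inf (b * q ^ n) q / qpoch q q n\<bar> * (q ^ (n * (n - 1) div 2) * \<bar>z\<bar> ^ n)
        \<le> C / (1 - q) ^ n * (q ^ (n * (n - 1) div 2) * \<bar>z\<bar> ^ n)"
      using q by (intro mult_right_mono) auto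
    then show ?thesis
      using q by (simp add: \<Psi>_term_def abs_mult power_abs power_divide mult_ac)
  qed
  moreover have "summable (\<lambda>n. C * (q ^ (n * (n - 1) div 2) * (\<bar>z\<bar> / (1 - q)) ^ n))"
    using q by (intro summable_mult summable_triangle_power) auto
  ultimately have "summable (\<Psi>_term a b z)"
    using summable_comparison_test' by blast
  then show ?thesis
    by (simp add: \<Psi>_def \<Psi>_term_def[abs_def] summable_sums)
qed

text \<open>The first factor \<open>1 - b * q ^ n\<close> of \<open>qpoch_inf (b * q ^ n) q\<close>
  is split off, and the power \<open>q ^ n\<close> in it is absorbed into \<open>z\<close>.\<close>

lemma \<Psi>_term_shift: "\<Psi>_term a b z n = \<Psi>_term a (q * b) z n - b * \<Psi>_term a (q * b) (q * z) n"
  using qpoch_inf_rec[of "b * q ^ n"] unfolding \<Psi>_term_def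
  by (simp add: mult_ac power_mult_distrib left_diff_distrib right_diff_distrib diff_divide_distrib)

lemma \<Psi>_shift: "\<Psi> a b q z = \<Psi> a (q * b) q z - b * \<Psi> a (q * b) q (q * z)"
proof (rule sums_unique2[OF \<Psi>_sums])
  show "\<Psi>_term a b z sums (\<Psi> a (q * b) q z - b * \<Psi> a (q * b) q (q * z))"
    unfolding \<Psi>_term_shift[of a b z, abs_def]
    by (intro sums_diff sums_mult \<Psi>_sums)
qed

text \<open>The \<open>q\<close>-difference in \<open>z\<close> multiplies the term by
  \<open>1 - q ^ Suc n\<close>. This cancels the last factor of \<open>qpoch q q (Suc n)\<close> and
  so lowers the index by one.\<close>

lemma \<Psi>_term_Suc_diff:
  "\<Psi>_term a b z (Suc n) - \<Psi>_term a b (q * z) (Suc n)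
    = - z * (1 - a * q ^ n) * \<Psi>_term a (q * b) (q * z) n"
proof -
  define R where "R = qpoch a q n * qpoch_inf (b * q ^ Suc n) q / qpoch q q n * (-1) ^ n
    * q ^ (n * (n - 1) div 2) * q ^ n * z ^ n"
  have "q ^ Suc n < 1" using q by (rule power_Suc_less_one)
  then have "1 - q ^ Suc n \<noteq> 0" by simp
  moreover have "qpoch q q (Suc n) = qpoch q q n * (1 - q ^ Suc n)" by (simp add: qpoch_def)
  moreover have "q ^ (Suc n * (Suc n - 1) div 2) = q ^ (n * (n - 1) div 2) * q ^ n"
    using arg_cong[OF triangle_Suc[of n], of "(^) q"] by (simp add: power_add del: mult_Suc)
  ultimately have "\<Psi>_term a b w (Suc n) * (1 - q ^ Suc n)
      = - (qpoch a q n * (1 - a * q ^ n) * qpoch_inf (b * q ^ Suc n) q / qpoch q q n * (-1) ^ n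
        * (q ^ (n * (n - 1) div 2) * q ^ n) * w ^ Suc n)" for w
    unfolding \<Psi>_term_def by (simp add: qpoch_def)
  from this[of z] have "\<Psi>_term a b z (Suc n) * (1 - q ^ Suc n) = - z * (1 - a * q ^ n) * R"
    by (simp add: R_def mult_ac)
  moreover have "\<Psi>_term a b (q * z) (Suc n) = q ^ Suc n * \<Psi>_term a b z (Suc n)"
    unfolding \<Psi>_term_def power_mult_distrib by simp
  moreover have "\<Psi>_term a (q * b) (q * z) n = R"
    unfolding \<Psi>_term_def R_def by (simp add: power_mult_distrib mult_ac)
  ultimately show ?thesis by (simp add: algebra_simps)
qed

text \<open>The hypothesis gives \<open>z * (1 - a * q ^ n) = (z - c) + c * (1 - b * q ^ n)\<close>,
  and the factor \<open>1 - b * q ^ n\<close> turns a term with \<open>q * b\<close> into one with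
  \<open>b\<close>. The \<open>q\<close>-difference of \<open>\<Psi>\<close> in \<open>z\<close>
  thus becomes a combination of two values of \<open>\<Psi>\<close>.\<close>

lemma \<Psi>_contiguous:
  assumes "a * z = c * b"
  shows "\<Psi> a b q z = (1 - c) * \<Psi> a b q (q * z) + (c - z) * \<Psi> a (q * b) q (q * z)"
proof -
  have "(\<lambda>n. \<Psi>_term a b z n - \<Psi>_term a b (q * z) n) sums (\<Psi> a b q z - \<Psi> a b q (q * z))"
    by (intro sums_diff \<Psi>_sums)
  then have "(\<lambda>n. \<Psi>_term a b z (Suc n) - \<Psi>_term a b (q * z) (Suc n)) sums (\<Psi> a b q z - \<Psi> a b q (q * z))"
    by (subst sums_Suc_iff) (simp add: \<Psi>_term_def)
  moreover have "\<Psi>_term a b z (Suc n) - \<Psi>_term a b (q * z) (Suc n)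
      = (c - z) * \<Psi>_term a (q * b) (q * z) n - c * \<Psi>_term a b (q * z) n" for n
  proof -
    have "\<Psi>_term a b (q * z) n = (1 - b * q ^ n) * \<Psi>_term a (q * b) (q * z) n"
      using qpoch_inf_rec[of "b * q ^ n"] by (simp add: \<Psi>_term_def mult_ac)
    then have "(c - z) * \<Psi>_term a (q * b) (q * z) n - c * \<Psi>_term a b (q * z) n
      = (c * b * q ^ n - z) * \<Psi>_term a (q * b) (q * z) n" by (simp only: ring_distribs mult_ac)
    then show ?thesis
      unfolding \<Psi>_term_Suc_diff assms[symmetric] by (simp add: algebra_simps)
  qed
  ultimately have "(\<lambda>n. (c - z) * \<Psi>_term a (q * b) (q * z) n - c * \<Psi>_term a b (q * z) n)
      sums (\<Psi> a b q z - \<Psi> a b q (q * z))" by simp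
  moreover have "(\<lambda>n. (c - z) * \<Psi>_term a (q * b) (q * z) n - c * \<Psi>_term a b (q * z) n)
      sums ((c - z) * \<Psi> a (q * b) q (q * z) - c * \<Psi> a b q (q * z))"
    by (intro sums_diff sums_mult \<Psi>_sums)
  ultimately have "\<Psi> a b q z - \<Psi> a b q (q * z)
      = (c - z) * \<Psi> a (q * b) q (q * z) - c * \<Psi> a b q (q * z)"
    by (rule sums_unique2)
  then show ?thesis by (simp add: algebra_simps)
qed

text \<open>The two cases in which the term with \<open>x / q = -1 \<notin> I\<^sub>q\<close> drops out of the second relation for
  \<open>a\<^sub>p(x, y)\<close>: \<open>\<Psi>(a; a; q, z) = (a, z; q)\<^sub>\<infinity>\<close> vanishes when \<open>a\<close> or \<open>z\<close> is \<open>q\<^sup>-\<^sup>k\<close>.\<close>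

lemma \<Psi>_diag_inverse_power_arg: "\<Psi> a a q (inverse (q ^ k)) = 0"
proof (induction k)
  case 0
  then show ?case using \<Psi>_contiguous[of a 1 1 a] by simp
next
  case (Suc k)
  \<comment> \<open>For \<open>b = a\<close> the choice \<open>c = z\<close> is admissible and kills
    the second term, leaving \<open>\<Psi> a a q z = (1 - z) * \<Psi> a a q (q * z)\<close>.\<close>
  have "q * inverse (q ^ Suc k) = inverse (q ^ k)" using q by (simp add: field_simps)
  then show ?case
    using \<Psi>_contiguous[of a "inverse (q ^ Suc k)" "inverse (q ^ Suc k)" a] Suc
    by (simp add: mult.commute del: power_Suc)
qed

lemma \<Psi>_diag_inverse_power: "\<Psi> (inverse (q ^ k)) (inverse (q ^ k)) q z = 0"
  unfolding \<Psi>_def qpoch_mult_inf qpoch_inf_inverse_power by simp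

end

section \<open>Contiguous relations for \<open>a\<^sub>p(x, y)\<close>\<close>

lemma kappa_divide: "kappa (x / y) = kappa x / kappa y"
proof -
  have "sgn x / sgn y = sgn x * sgn y" by (simp add: sgn_if)
  then show "kappa (x / y) = kappa x / kappa y"
    by (simp add: kappa_def sgn_divide power_divide times_divide_times_eq[symmetric] del: times_divide_times_eq)
qed

lemma kappa_eq_0_iff: "kappa x = 0 \<longleftrightarrow> x = 0"
  by (simp add: kappa_def sgn_zero_iff)

context
  fixes q :: real
  assumes q: "0 < q" "q < 1"
begin

section \<open>The set \<open>Iq q\<close>, the lattice around it, and the functions
  \<open>chi\<close>, \<open>nu\<close> and \<open>kappa\<close>\<close>

lemma Iq_iff: "x \<in> Iq q \<longleftrightarrow> (\<exists>k. x = q powi k \<or> k \<ge> 1 \<and> x = - (q powi k))"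
proof -
  have "(\<exists>n. x = - (q ^ n) \<and> n \<ge> (1::nat)) \<longleftrightarrow> (\<exists>k\<ge>1. x = - (q powi k))"
    by (metis nonneg_int_cases int_one_le_iff_zero_less less_one not_less of_nat_1 of_nat_le_iff
        order_trans power_int_of_nat zero_le_one)
  then show ?thesis unfolding Iq_def by blast
qed

text \<open>This is \<open>- q\<^sup>\<int> \<union> q\<^sup>\<int>\<close>. Neighbours and
  quotients of elements of \<open>Iq q\<close> may leave \<open>Iq q\<close> but stay here, where
  \<open>chi\<close> turns products into sums.\<close>

definition lattice :: "real set"
  where "lattice = {x. \<exists>k. \<bar>x\<bar> = q powi k}"

lemma Iq_subset_lattice: "x \<in> Iq q \<Longrightarrow> x \<in> lattice"
  using q by (auto simp: Iq_iff lattice_def)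

lemma lattice_nonzero: "x \<in> lattice \<Longrightarrow> x \<noteq> 0"
  using q by (auto simp: lattice_def)

lemma lattice_mult: "x \<in> lattice \<Longrightarrow> y \<in> lattice \<Longrightarrow> x * y \<in> lattice"
  and lattice_divide: "x \<in> lattice \<Longrightarrow> y \<in> lattice \<Longrightarrow> x / y \<in> lattice"
  using q unfolding lattice_def mem_Collect_eq abs_mult abs_divide
  by (metis power_int_add power_int_diff less_irrefl)+

lemma lattice_powi: "q powi k \<in> lattice"
  using q by (auto simp: lattice_def)

lemma lattice_q: "q \<in> lattice"
  using lattice_powi[of 1] by simp

lemma chi_powi: "\<bar>x\<bar> = q powi k \<Longrightarrow> chi q x = k"
  using q by (simp add: chi_def powr_real_of_int'[symmetric] log_powr)

lemma powi_chi: "x \<in> lattice \<Longrightarrow> q powi chi q x = \<bar>x\<bar>"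
  using chi_powi by (auto simp: lattice_def)

lemma chi_mult: "x \<in> lattice \<Longrightarrow> y \<in> lattice \<Longrightarrow> chi q (x * y) = chi q x + chi q y"
  using q by (intro chi_powi) (simp add: power_int_add powi_chi abs_mult)

lemma chi_divide: "x \<in> lattice \<Longrightarrow> y \<in> lattice \<Longrightarrow> chi q (x / y) = chi q x - chi q y"
  using q by (intro chi_powi) (simp add: power_int_diff powi_chi abs_divide)

lemma chi_q: "chi q q = 1"
  using q by (intro chi_powi) simp

text \<open>The exponents of \<open>nu\<close> are triangular numbers, so the step from
  \<open>u\<close> to \<open>q * u\<close> adds \<open>chi q u - 1\<close>, which is linear.\<close>

lemma nu_mult_q: 
  assumes u: "u \<in> lattice"
  shows "nu q (q * u) = nu q u * \<bar>u\<bar> / q"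
proof -
  have "real_of_int ((chi q (q * u) - 1) * (chi q (q * u) - 2)) / 2
      = real_of_int ((chi q u - 1) * (chi q u - 2)) / 2 + real_of_int (chi q u - 1)"
    using chi_mult[OF lattice_q u] by (simp add: chi_q field_simps)
  then have "nu q (q * u) = nu q u * q powr real_of_int (chi q u - 1)"
    unfolding nu_def by (simp only: powr_add)
  also have "q powr real_of_int (chi q u - 1) = \<bar>u\<bar> / q"
    using powr_real_of_int'[of q "chi q u - 1"] q u by (simp add: power_int_diff powi_chi)
  finally show ?thesis by simp
qed

lemma nu_divide_q: 
  assumes u: "u \<in> lattice"
  shows "nu q (u / q) = nu q u * q\<^sup>2 / \<bar>u\<bar>"
  using nu_mult_q[OF lattice_divide[OF u lattice_q]] q lattice_nonzero[OF u]
  by (simp add: field_simps power2_eq_square)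

lemma kappa_mult_q: "kappa (q * x) = q\<^sup>2 * kappa x"
  and kappa_divide_q: "kappa (x / q) = kappa x / q\<^sup>2"
  using q by (simp_all add: kappa_def sgn_mult sgn_divide power_mult_distrib power_divide)

lemma Iq_mult_q: "x \<in> Iq q \<Longrightarrow> q * x \<in> Iq q"
  unfolding Iq_iff using q
  by (metis mult_minus_right power_int_add_1' less_irrefl add_increasing2 zero_le_one)

text \<open>The one exception is \<open>x = - q\<close>. Its neighbour -1 is the zero of
  \<open>1 + kappa\<close>, the radicand in the coefficients of \<open>E0\<close>.\<close>

lemma Iq_divide_q: "x \<in> Iq q \<Longrightarrow> x / q \<in> Iq q \<or> kappa (x / q) = -1"
proof -
  assume "x \<in> Iq q"
  then obtain k where k: "x = q powi k \<or> k \<ge> 1 \<and> x = - (q powi k)" unfolding Iq_iff by blast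
  have *: "q powi k / q = q powi (k - 1)" using q by (simp add: power_int_diff)
  show ?thesis
  proof (cases "k = 1")
    case True
    then show ?thesis using k q by (auto simp: Iq_iff kappa_def intro!: exI[of _ 0])
  next
    case False
    then have "x / q = q powi (k - 1) \<or> k - 1 \<ge> 1 \<and> x / q = - (q powi (k - 1))"
      using k * by auto
    then show ?thesis unfolding Iq_iff by blast
  qed
qed

lemma kappa_Iq_gt: "x \<in> Iq q \<Longrightarrow> 1 + kappa x > 0"
proof -
  assume "x \<in> Iq q"
  then obtain k where k: "x = q powi k \<or> k \<ge> 1 \<and> x = - (q powi k)" unfolding Iq_iff by blast
  then show ?thesis
  proof
    assume "x = q powi k"
    then show ?thesis using q by (simp add: kappa_def add_pos_nonneg)
  next
    assume x: "k \<ge> 1 \<and> x = - (q powi k)"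
    then have "q powi k \<le> q powi 1" using q by (intro power_int_decreasing) auto
    then have "q powi k < 1" using q by simp
    then have "(q powi k)\<^sup>2 < 1" using q by (intro power_less_one_iff[THEN iffD2]) auto
    then show ?thesis using x q by (simp add: kappa_def)
  qed
qed

lemma kappa_divide_q_ge: "x \<in> Iq q \<Longrightarrow> 1 + kappa (x / q) \<ge> 0"
  using Iq_divide_q[of x] kappa_Iq_gt[of "x / q"] by auto

lemma q2: "0 < q\<^sup>2" "q\<^sup>2 < 1"
  using q by (auto simp: power_less_one_iff)

section \<open>The two three-term relations for \<open>a_fun\<close>\<close>

lemma qpoch_inf_kappa_mult_q:
  "qpoch_inf (- kappa x) (q\<^sup>2) = (1 + kappa x) * qpoch_inf (- kappa (q * x)) (q\<^sup>2)"
  using qpoch_inf_rec[OF q2, of "- kappa x"] by (simp add: kappa_mult_q mult_ac)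

lemma sqrt_divide_cancel: "sqrt (1 + k) * sqrt (A / B) = (1 + k) * sqrt (A / ((1 + k) * B))"
  if "1 + k > 0" for k A B :: real
proof -
  have "sqrt (1 + k) * sqrt (1 + k) = 1 + k" using that by simp
  then have "(1 + k) * sqrt (A / ((1 + k) * B)) = sqrt (1 + k) * (sqrt (1 + k) * sqrt (A / ((1 + k) * B)))"
    by (metis mult.assoc)
  also have "sqrt (1 + k) * sqrt (A / ((1 + k) * B)) = sqrt (A / B)"
    using that by (simp add: real_sqrt_mult[symmetric])
  finally show ?thesis by simp
qed

lemma sqrt_mult_cancel: "sqrt (1 + k) * sqrt ((1 + k) * A) = (1 + k) * sqrt A"
  if "1 + k \<ge> 0" for k A :: real
  using that by (simp add: real_sqrt_mult mult.assoc[symmetric])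

lemma sgn_eq_mult: "sgn (x * y) = sgn p \<Longrightarrow> y \<noteq> 0 \<Longrightarrow> sgn x * sgn y = sgn p \<and> sgn p * sgn y = sgn x"
  for x y p :: real
  by (auto simp: sgn_if zero_less_mult_iff mult_less_0_iff split: if_splits)

text \<open>Passing from \<open>x\<close> to \<open>q * x\<close> multiplies both \<open>b\<close>
  and \<open>z\<close> by \<open>q\<^sup>2\<close>, passing from \<open>p\<close> to
  \<open>p / q\<close> only \<open>z\<close>. These are the functions in
  \<open>\<Psi>_contiguous\<close>, taken in base \<open>q\<^sup>2\<close> with
  \<open>c = - 1 / kappa (p / q)\<close>. The outer roots complete those inside \<open>a_fun\<close>
  to the factors \<open>1 + kappa x\<close> and \<open>1 + kappa (p / q)\<close>; the second is 0 at
  \<open>p = - q\<close>, so the boundary takes care of itself.\<close>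

lemma a_fun_up:
  assumes pxy: "p \<in> Iq q" "x \<in> Iq q" "y \<in> Iq q"
  shows "sgn p * sqrt (1 + kappa (p / q)) * a_fun q (p / q) x y
      - sgn x * sqrt (1 + kappa x) * a_fun q p (q * x) y = - \<bar>x * p / y\<bar> * a_fun q p x y"
proof (cases "sgn (x * y) = sgn p")
  case False
  then show ?thesis using q by (simp add: a_fun_def sgn_mult sgn_divide)
next
  case True
  note l = pxy[THEN Iq_subset_lattice]
  note nz = l[THEN lattice_nonzero]
  define a where "a = - (q\<^sup>2) / kappa y"
  define b where "b = q\<^sup>2 * kappa (x / y)"
  define z where "z = q\<^sup>2 * kappa (x / p)"
  define N where "N = nu q (p * y / x)"
  define \<sigma> where "\<sigma> = - sgn y"
  define C where "C = c_q q * sxy x y * (-1) powi (chi q p) * \<sigma> powi (chi q x) * \<bar>y\<bar>"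
  define L where "L u = qpoch_inf (- kappa u) (q\<^sup>2)" for u
  define S where "S = sqrt (L p * L y / L x)"
  define M where "M = C * (N * q\<^sup>2 / \<bar>p * y / x\<bar>) * S"
  have \<sigma>: "\<sigma> \<noteq> 0" using nz by (simp add: \<sigma>_def sgn_zero_iff)
  have nu: "nu q (p * y / (q * x)) = N * q\<^sup>2 / \<bar>p * y / x\<bar>"
    using nu_divide_q[of "p * y / x"] l by (simp add: N_def lattice_mult lattice_divide mult.commute)
  have kap: "kappa (q * x / y) = q\<^sup>2 * kappa (x / y)" "kappa (q * x / p) = q\<^sup>2 * kappa (x / p)"
    "kappa (x / (p / q)) = q\<^sup>2 * kappa (x / p)" "p / q * y / x = p * y / (q * x)"
    using kappa_mult_q[of "x / y"] kappa_mult_q[of "x / p"] by (simp_all add: mult_ac)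
  have sg: "sgn (q * x * y) = sgn p" "sgn (x * y) = sgn (p / q)"
    using True q by (simp_all add: sgn_mult sgn_divide)
  have ch: "chi q (q * x) = chi q x + 1" "chi q (p / q) = chi q p - 1"
    using l by (simp_all add: chi_mult chi_divide chi_q lattice_q)
  have A0: "a_fun q p x y = C * N * S * \<Psi> a b (q\<^sup>2) z"
    using True by (simp add: a_fun_def C_def N_def L_def S_def a_def b_def z_def \<sigma>_def)
  have "sxy (q * x) y = sxy x y" using q by (simp add: sxy_def zero_less_mult_iff)
  then have A1: "a_fun q p (q * x) y = C * \<sigma> * (N * q\<^sup>2 / \<bar>p * y / x\<bar>) * sqrt (L p * L y / L (q * x))
      * \<Psi> a (q\<^sup>2 * b) (q\<^sup>2) (q\<^sup>2 * z)"
    using sg(1) power_int_add_1[of \<sigma> "chi q x"] \<sigma>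
    unfolding a_fun_def nu kap ch C_def L_def a_def b_def z_def \<sigma>_def[symmetric]
    by (simp only: not_True_eq_False if_False mult_ac simp_thms)
  have A2: "a_fun q (p / q) x y = - C * (N * q\<^sup>2 / \<bar>p * y / x\<bar>) * sqrt (L (p / q) * L y / L x)
      * \<Psi> a b (q\<^sup>2) (q\<^sup>2 * z)"
  proof -
    have "(-1 :: real) powi (chi q p - 1) = - ((-1) powi chi q p)" by (simp add: power_int_diff)
    then show ?thesis using sg(2)
      unfolding a_fun_def nu kap ch C_def L_def a_def b_def z_def \<sigma>_def[symmetric]
      by (simp only: not_True_eq_False if_False mult_minus_left mult_minus_right mult_ac simp_thms)
  qed
  have eq: "sqrt (1 + kappa x) * sqrt (L p * L y / L (q * x)) = (1 + kappa x) * S"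
    using qpoch_inf_kappa_mult_q[of x] sqrt_divide_cancel[OF kappa_Iq_gt[OF pxy(2)]]
    by (simp add: S_def L_def)
  have "sqrt (1 + kappa x) * a_fun q p (q * x) y
      = (sqrt (1 + kappa x) * sqrt (L p * L y / L (q * x))) *
        (C * (N * q\<^sup>2 / \<bar>p * y / x\<bar>) * \<sigma> * \<Psi> a (q\<^sup>2 * b) (q\<^sup>2) (q\<^sup>2 * z))"
    unfolding A1 by (simp only: mult_ac)
  then have B1: "sqrt (1 + kappa x) * a_fun q p (q * x) y
      = M * \<sigma> * (1 + kappa x) * \<Psi> a (q\<^sup>2 * b) (q\<^sup>2) (q\<^sup>2 * z)"
    unfolding eq M_def by (simp only: mult_ac)
  have eq': "sqrt (1 + kappa (p / q)) * sqrt (L (p / q) * L y / L x) = (1 + kappa (p / q)) * S"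
    using qpoch_inf_kappa_mult_q[of "p / q"] sqrt_mult_cancel[OF kappa_divide_q_ge[OF pxy(1)], of "L p * L y / L x"] q
    by (simp add: S_def L_def mult.assoc)
  have "sqrt (1 + kappa (p / q)) * a_fun q (p / q) x y
      = (sqrt (1 + kappa (p / q)) * sqrt (L (p / q) * L y / L x)) *
        (- C * (N * q\<^sup>2 / \<bar>p * y / x\<bar>) * \<Psi> a b (q\<^sup>2) (q\<^sup>2 * z))"
    unfolding A2 by (simp only: mult_ac)
  then have B2: "sqrt (1 + kappa (p / q)) * a_fun q (p / q) x y
      = - M * (1 + kappa (p / q)) * \<Psi> a b (q\<^sup>2) (q\<^sup>2 * z)"
    unfolding eq' M_def by (simp only: mult_ac mult_minus_left mult_minus_right)
  have k: "kappa p \<noteq> 0" "kappa y \<noteq> 0" "kappa x \<noteq> 0" using nz by (simp_all add: kappa_eq_0_iff)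
  have "a * z = (- 1 / kappa (p / q)) * b"
    using k q by (simp add: a_def b_def z_def kappa_divide[of x] kappa_divide_q power2_eq_square)
  from \<Psi>_contiguous[OF q2 this] have "kappa (p / q) * \<Psi> a b (q\<^sup>2) z
     = kappa (p / q) * (1 - - 1 / kappa (p / q)) * \<Psi> a b (q\<^sup>2) (q\<^sup>2 * z)
       + kappa (p / q) * (- 1 / kappa (p / q) - z) * \<Psi> a (q\<^sup>2 * b) (q\<^sup>2) (q\<^sup>2 * z)"
    by (simp only: distrib_left mult.assoc)
  moreover have "kappa (p / q) \<noteq> 0" "kappa (p / q) * z = kappa x"
    using k q by (simp_all add: z_def kappa_divide[of x] kappa_divide_q)
  then have "kappa (p / q) * (1 - - 1 / kappa (p / q)) = 1 + kappa (p / q)"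
    "kappa (p / q) * (- 1 / kappa (p / q) - z) = - (1 + kappa x)"
    by (simp_all add: right_diff_distrib distrib_left)
  ultimately have "kappa (p / q) * \<Psi> a b (q\<^sup>2) z
     = (1 + kappa (p / q)) * \<Psi> a b (q\<^sup>2) (q\<^sup>2 * z) - (1 + kappa x) * \<Psi> a (q\<^sup>2 * b) (q\<^sup>2) (q\<^sup>2 * z)"
    by (simp only: mult_minus_left diff_conv_add_uminus)
  then have rel: "- (sgn x * sgn y) * M * (kappa (p / q) * \<Psi> a b (q\<^sup>2) z)
    = - (sgn x * sgn y) * M * ((1 + kappa (p / q)) * \<Psi> a b (q\<^sup>2) (q\<^sup>2 * z)
      - (1 + kappa x) * \<Psi> a (q\<^sup>2 * b) (q\<^sup>2) (q\<^sup>2 * z))" by (simp only:)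
  have "sgn x * sgn y = sgn p" using sgn_eq_mult[OF True nz(3)] by simp
  then have "sgn p * sqrt (1 + kappa (p / q)) * a_fun q (p / q) x y
      - sgn x * sqrt (1 + kappa x) * a_fun q p (q * x) y
      = (sgn x * sgn y) * (sqrt (1 + kappa (p / q)) * a_fun q (p / q) x y)
      - sgn x * (sqrt (1 + kappa x) * a_fun q p (q * x) y)"
    by (simp only: mult.assoc)
  also have "\<dots> = - (sgn x * sgn y) * M * (kappa (p / q) * \<Psi> a b (q\<^sup>2) z)"
    unfolding B1 B2 rel \<sigma>_def by (simp add: algebra_simps)
  also have "\<dots> = - sgn p * M * (kappa (p / q) * \<Psi> a b (q\<^sup>2) z)"
    using sgn_eq_mult[OF True nz(3)] by simp
  also have "\<dots> = - (sgn p * kappa (p / q) * (q\<^sup>2 / \<bar>p * y / x\<bar>)) * (C * N * S * \<Psi> a b (q\<^sup>2) z)"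
    unfolding M_def by (simp only: mult_minus_left mult_minus_right mult_ac times_divide_eq_right[symmetric])
  also have "sgn p * kappa (p / q) * (q\<^sup>2 / \<bar>p * y / x\<bar>) = \<bar>x * p / y\<bar>"
  proof -
    have "sgn p * kappa (p / q) * q\<^sup>2 = \<bar>p\<bar> * \<bar>p\<bar>"
      using q by (simp add: kappa_divide_q) (simp add: kappa_def sgn_if power2_eq_square)
    then show ?thesis using nz q by (simp add: abs_mult abs_divide field_simps)
  qed
  finally show ?thesis unfolding A0 .
qed

text \<open>Negative elements of \<open>Iq q\<close> have exponent \<open>k \<ge> 1\<close>, so
  \<open>n = k - 1\<close> is natural and \<open>- (q\<^sup>2) / kappa x\<close> is one of the
  inverse powers at which the diagonal \<open>\<Psi>\<close> vanishes.\<close>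

lemma Iq_negD: 
  assumes "x \<in> Iq q" "x < 0"
  obtains n where "q\<^sup>2 / kappa x = - inverse ((q\<^sup>2) ^ n)"
proof -
  obtain k where k: "k \<ge> 1" "x = - (q powi k)" using assms q unfolding Iq_iff
    by (metis zero_less_power_int less_asym)
  then have "q powi k = q * q ^ nat (k - 1)"
    using q power_int_add_1'[of q "k - 1"] by (simp add: power_int_def)
  then have "kappa x = - (q\<^sup>2 * (q\<^sup>2) ^ nat (k - 1))"
    using k(2) assms(2) by (simp add: kappa_def power_mult_distrib power_mult[symmetric] mult.commute)
  then show ?thesis using q that[of "nat (k - 1)"] by (simp add: divide_inverse)
qed

text \<open>Now \<open>x / q\<close> divides both \<open>b\<close> and \<open>z\<close> by
  \<open>q\<^sup>2\<close>, and \<open>q * p\<close> only \<open>z\<close>, so the relation is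
  \<open>\<Psi>_shift\<close> at \<open>b / q\<^sup>2\<close> and \<open>z / q\<^sup>2\<close>. The
  roots cancel here instead of combining, so no prefactor vanishes at \<open>x / q = -1\<close> and
  \<open>\<Psi>\<close> itself has to.\<close>

lemma a_fun_down:
  assumes pxy: "p \<in> Iq q" "x \<in> Iq q" "y \<in> Iq q"
  shows "sgn p * sqrt (1 + kappa p) * a_fun q (q * p) x y
      - sgn x * sqrt (1 + kappa (x / q)) * a_fun q p (x / q) y = - (\<bar>x * p / y\<bar> / q) * a_fun q p x y"
proof (cases "sgn (x * y) = sgn p")
  case False
  then show ?thesis using q by (simp add: a_fun_def sgn_mult sgn_divide)
next
  case True
  note l = pxy[THEN Iq_subset_lattice]
  note nz = l[THEN lattice_nonzero]
  define a where "a = - (q\<^sup>2) / kappa y"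
  define b where "b = q\<^sup>2 * kappa (x / y)"
  define z where "z = q\<^sup>2 * kappa (x / p)"
  define N where "N = nu q (p * y / x)"
  define \<sigma> where "\<sigma> = - sgn y"
  define C where "C = c_q q * sxy x y * (-1) powi (chi q p) * \<sigma> powi (chi q x) * \<bar>y\<bar>"
  define L where "L u = qpoch_inf (- kappa u) (q\<^sup>2)" for u
  define S where "S = sqrt (L p * L y / L x)"
  define M where "M = C * (N * \<bar>p * y / x\<bar> / q) * S"
  have \<sigma>: "\<sigma> * \<sigma> = 1" using nz by (simp add: \<sigma>_def sgn_if)
  have nu: "nu q (q * (p * y / x)) = N * \<bar>p * y / x\<bar> / q"
    using nu_mult_q[of "p * y / x"] l by (simp add: N_def lattice_mult lattice_divide)
  have kap: "q\<^sup>2 * kappa (x / q / y) = b / q\<^sup>2" "q\<^sup>2 * kappa (x / q / p) = z / q\<^sup>2"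
    "q\<^sup>2 * kappa (x / (q * p)) = z / q\<^sup>2" "p * y / (x / q) = q * (p * y / x)"
    "q * p * y / x = q * (p * y / x)"
    using kappa_divide_q[of "x / y"] kappa_divide_q[of "x / p"] q
    by (simp_all add: b_def z_def mult_ac)
  have sg: "sgn (x / q * y) = sgn p" "sgn (x * y) = sgn (q * p)"
    using True q by (simp_all add: sgn_mult sgn_divide)
  have ch: "chi q (x / q) = chi q x - 1" "chi q (q * p) = chi q p + 1"
    using l by (simp_all add: chi_mult chi_divide chi_q lattice_q)
  have A0: "a_fun q p x y = C * N * S * \<Psi> a b (q\<^sup>2) z"
    using True by (simp add: a_fun_def C_def N_def L_def S_def a_def b_def z_def \<sigma>_def)
  have sx: "sxy (x / q) y = sxy x y" using q by (simp add: sxy_def zero_less_divide_iff)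
  have A1: "a_fun q p (x / q) y = C * \<sigma> * (N * \<bar>p * y / x\<bar> / q) * sqrt (L p * L y / L (x / q))
      * \<Psi> a (b / q\<^sup>2) (q\<^sup>2) (z / q\<^sup>2)"
  proof -
    have "\<sigma> \<noteq> 0" using \<sigma> by auto
    then have "\<sigma> powi (chi q x - 1) * (\<sigma> * \<sigma>) = \<sigma> powi chi q x * \<sigma>"
      using power_int_add_1[of \<sigma> "chi q x - 1"] by simp
    then have "\<sigma> powi (chi q x - 1) = \<sigma> powi chi q x * \<sigma>" by (simp add: \<sigma>)
    then show ?thesis using sg(1)
      unfolding a_fun_def kap nu ch sx C_def L_def a_def \<sigma>_def[symmetric]
      by (simp only: not_True_eq_False if_False mult_ac simp_thms)
  qed
  have A2: "a_fun q (q * p) x y = - C * (N * \<bar>p * y / x\<bar> / q) * sqrt (L (q * p) * L y / L x)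
      * \<Psi> a b (q\<^sup>2) (z / q\<^sup>2)"
  proof -
    have "(-1 :: real) powi (chi q p + 1) = - ((-1) powi chi q p)" by (simp add: power_int_add)
    then show ?thesis using sg(2)
      unfolding a_fun_def kap nu ch C_def L_def a_def b_def \<sigma>_def[symmetric]
      by (simp only: not_True_eq_False if_False mult_minus_left mult_minus_right mult_ac simp_thms)
  qed
  have k: "kappa p \<noteq> 0" "kappa y \<noteq> 0" "kappa x \<noteq> 0" using nz by (simp_all add: kappa_eq_0_iff)
  have B1: "sqrt (1 + kappa (x / q)) * a_fun q p (x / q) y
      = M * \<sigma> * \<Psi> a (b / q\<^sup>2) (q\<^sup>2) (z / q\<^sup>2)"
  proof (cases "kappa (x / q) = -1")
    \<comment> \<open>Here \<open>x = - q\<close>, so \<open>b / q\<^sup>2 = a\<close> and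
      \<open>\<Psi>\<close> is on the diagonal. The sign condition forces \<open>y < 0\<close>,
      which makes \<open>a\<close> an inverse power of \<open>q\<^sup>2\<close>, or
      \<open>p < 0\<close>, which does the same for \<open>z / q\<^sup>2\<close>.\<close>
    case True
    then have kx: "kappa x = - q\<^sup>2" using q by (simp add: kappa_divide_q field_simps)
    then have "kappa x < 0" using q2 by linarith
    then have "x < 0" by (auto simp: kappa_def sgn_if split: if_splits)
    then have "y < 0 \<or> p < 0"
      using \<open>sgn (x * y) = sgn p\<close> nz by (auto simp: sgn_if zero_less_mult_iff split: if_splits)
    moreover have "b / q\<^sup>2 = kappa (x / y)" "z / q\<^sup>2 = kappa (x / p)"
      using q by (simp_all add: b_def z_def)
    then have ab: "b / q\<^sup>2 = a" and zq: "z / q\<^sup>2 = - (q\<^sup>2 / kappa p)"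
      using kx by (simp_all add: a_def kappa_divide)
    ultimately have "\<Psi> a (b / q\<^sup>2) (q\<^sup>2) (z / q\<^sup>2) = 0"
      using Iq_negD[OF pxy(3)] Iq_negD[OF pxy(1)] \<Psi>_diag_inverse_power[OF q2]
        \<Psi>_diag_inverse_power_arg[OF q2]
      unfolding ab zq a_def minus_divide_left[symmetric] by (metis minus_minus)
    then show ?thesis using True by simp
  next
    case False
    then have "1 + kappa (x / q) \<noteq> 0" by linarith
    then have eq: "sqrt (1 + kappa (x / q)) * sqrt (L p * L y / L (x / q)) = S"
      using qpoch_inf_kappa_mult_q[of "x / q"] q by (simp add: S_def L_def real_sqrt_mult[symmetric])
    have "sqrt (1 + kappa (x / q)) * a_fun q p (x / q) y
        = (sqrt (1 + kappa (x / q)) * sqrt (L p * L y / L (x / q)))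
          * (C * \<sigma> * (N * \<bar>p * y / x\<bar> / q) * \<Psi> a (b / q\<^sup>2) (q\<^sup>2) (z / q\<^sup>2))"
      unfolding A1 by (simp only: mult_ac)
    then show ?thesis unfolding eq M_def by (simp only: mult_ac)
  qed
  have eq': "sqrt (1 + kappa p) * sqrt (L (q * p) * L y / L x) = S"
    using qpoch_inf_kappa_mult_q[of p] by (simp add: S_def L_def real_sqrt_mult[symmetric] mult.assoc)
  have "sqrt (1 + kappa p) * a_fun q (q * p) x y
      = (sqrt (1 + kappa p) * sqrt (L (q * p) * L y / L x)) *
        (- C * (N * \<bar>p * y / x\<bar> / q) * \<Psi> a b (q\<^sup>2) (z / q\<^sup>2))"
    unfolding A2 by (simp only: mult_ac)
  then have B2: "sqrt (1 + kappa p) * a_fun q (q * p) x y = - M * \<Psi> a b (q\<^sup>2) (z / q\<^sup>2)"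
    unfolding eq' M_def by (simp only: mult_ac mult_minus_left mult_minus_right)
  have "\<Psi> a (b / q\<^sup>2) (q\<^sup>2) (z / q\<^sup>2)
      = \<Psi> a b (q\<^sup>2) (z / q\<^sup>2) - kappa (x / y) * \<Psi> a b (q\<^sup>2) z"
    using \<Psi>_shift[OF q2, of a "b / q\<^sup>2" "z / q\<^sup>2"] q by (simp add: b_def)
  note rel = this
  have "sgn x * sgn y = sgn p" using sgn_eq_mult[OF True nz(3)] by simp
  then have "sgn p * sqrt (1 + kappa p) * a_fun q (q * p) x y
      - sgn x * sqrt (1 + kappa (x / q)) * a_fun q p (x / q) y
      = (sgn x * sgn y) * (sqrt (1 + kappa p) * a_fun q (q * p) x y)
      - sgn x * (sqrt (1 + kappa (x / q)) * a_fun q p (x / q) y)"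
    by (simp only: mult.assoc)
  also have "\<dots> = - (sgn x * sgn y) * M * (kappa (x / y) * \<Psi> a b (q\<^sup>2) z)"
    unfolding B1 B2 rel \<sigma>_def by (simp add: algebra_simps)
  also have "\<dots> = - sgn p * M * (kappa (x / y) * \<Psi> a b (q\<^sup>2) z)"
    using sgn_eq_mult[OF True nz(3)] by simp
  also have "\<dots> = - (sgn p * kappa (x / y) * (\<bar>p * y / x\<bar> / q)) * (C * N * S * \<Psi> a b (q\<^sup>2) z)"
    unfolding M_def by (simp only: mult_minus_left mult_minus_right mult_ac times_divide_eq_right[symmetric])
  also have "sgn p * kappa (x / y) * (\<bar>p * y / x\<bar> / q) = \<bar>x * p / y\<bar> / q"
  proof -
    have "sgn x * sgn y = sgn (x / y)"
      by (auto simp: sgn_if zero_less_divide_iff)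
    then have "sgn p = sgn (x / y)" using sgn_eq_mult[OF True nz(3)] by simp
    then have "sgn p * kappa (x / y) = \<bar>x\<bar> * \<bar>x\<bar> / (\<bar>y\<bar> * \<bar>y\<bar>)"
      by (simp add: kappa_def sgn_if power2_eq_square abs_mult[symmetric])
    then show ?thesis using nz q by (simp add: abs_mult abs_divide field_simps)
  qed
  finally show ?thesis unfolding A0 .
qed

end

section \<open>Slices of \<open>W\<^sup>*\<close>\<close>

lemma coord_fb: "coord (fb q m p t) i = (if p \<in> Iq q \<and> t \<in> Iq q \<and> i = (m, p, t) then 1 else 0)"
  by (simp add: fb_def coord_ket coord_simps)

lemma fb_labels: "(m, p, t) \<in> labels q \<Longrightarrow> fb q m p t = ket (m, p, t)"
  by (simp add: fb_def labels_def)

context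
  fixes q :: real
  assumes q: "0 < q" "q < 1"
begin

lemma abs_powr_chi: "x \<in> lattice q \<Longrightarrow> \<bar>x\<bar> powr r = q powr (real_of_int (chi q x) * r)"
  using powi_chi[OF q, of x] q by (simp add: powr_powr[symmetric] powr_real_of_int')

lemma abs_chi: "x \<in> lattice q \<Longrightarrow> \<bar>x\<bar> = q powr real_of_int (chi q x)"
  using abs_powr_chi[of x 1] by simp

lemma abs_divide_powr:
  "x \<in> lattice q \<Longrightarrow> y \<in> lattice q \<Longrightarrow> \<bar>x / y\<bar> powr (1/2) = q powr (real_of_int (chi q x - chi q y) / 2)"
  using abs_powr_chi[OF lattice_divide[OF q]] by (simp add: chi_divide[OF q])

lemma powi_powr: "q powi k = q powr real_of_int k"
  using q by (simp add: powr_real_of_int')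

text \<open>The weight of the step from \<open>x\<close> to \<open>x * q powi - e\<close>; on
  \<open>Iq q\<close> it is 0 when this step leaves \<open>Iq q\<close>.\<close>

definition shift_root :: "int \<Rightarrow> real \<Rightarrow> real"
  where "shift_root e x = sqrt (1 + kappa (if e = 1 then x / q else x))"

lemma Iq_shift: "e \<in> {1, -1} \<Longrightarrow> x \<in> Iq q \<Longrightarrow> x * q powi - e \<in> Iq q \<or> shift_root e x = 0"
  and Iq_shift': "e \<in> {1, -1} \<Longrightarrow> x \<in> Iq q \<Longrightarrow> q powi e * x \<in> Iq q \<or> shift_root (- e) x = 0"
  using Iq_divide_q[OF q, of x] Iq_mult_q[OF q, of x]
  by (auto simp: shift_root_def power_int_minus divide_inverse mult.commute)

lemma a_fun_contiguous:
  assumes "e \<in> {1, -1}" "p \<in> Iq q" "x \<in> Iq q" "y \<in> Iq q"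
  shows "sgn p * shift_root e p * a_fun q (p * q powi - e) x y
      - sgn x * shift_root (- e) x * a_fun q p (q powi e * x) y
    = - (\<bar>x * p / y\<bar> * q powr (real_of_int (e - 1) / 2)) * a_fun q p x y"
  using assms(1)
proof
  assume e: "e = 1"
  have "p * q powi - 1 = p / q" using q by (simp add: power_int_minus field_simps)
  moreover have "q powi 1 * x = q * x" "q powr (real_of_int (1 - 1) / 2) = 1"
    "shift_root 1 p = sqrt (1 + kappa (p / q))" "shift_root (- 1) x = sqrt (1 + kappa x)"
    using q by (simp_all add: shift_root_def)
  ultimately show ?thesis unfolding e by (simp only: a_fun_up[OF q assms(2-4)] mult_1_right)
next
  assume "e \<in> {-1}"
  then have e: "e = -1" by simp
  have "q powi - 1 * x = x / q" using q by (simp add: power_int_minus field_simps)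
  moreover have "p * q powi 1 = q * p" "q powi - (- 1) = q powi 1"
    "shift_root (-1) p = sqrt (1 + kappa p)" "shift_root (- (-1)) x = sqrt (1 + kappa (x / q))"
    by (simp_all add: shift_root_def)
  moreover have "q powr (real_of_int (- 1 - 1) / 2) = 1 / q"
    using q by (simp add: powr_minus inverse_eq_divide)
  ultimately show ?thesis unfolding e
    by (simp only: a_fun_down[OF q assms(2-4)] times_divide_eq_right mult_1_right)
qed

definition K_eigen :: "lab \<Rightarrow> real"
  where "K_eigen = (\<lambda>(m, p, t). q powr (- real_of_int m / 2) * \<bar>p / t\<bar> powr (1/2))"

definition t_coeff :: "int \<Rightarrow> lab \<Rightarrow> real"
  where "t_coeff e = (\<lambda>(m, p, t). sgn t * q powr (- real_of_int (m - e) / 2) * \<bar>p / t\<bar> powr (1/2) * shift_root e t)"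

text \<open>\<open>shift_root\<close> gets \<open>- e\<close> because \<open>p\<close> moves in the
  direction opposite to \<open>t\<close>.\<close>

definition p_coeff :: "int \<Rightarrow> lab \<Rightarrow> real"
  where "p_coeff e = (\<lambda>(m, p, t). - (sgn p * q powr (real_of_int (m - e) / 2) * \<bar>t / p\<bar> powr (1/2) * shift_root (- e) p))"

text \<open>\<open>e = 1\<close> gives \<open>E\<^sub>0\<close> and \<open>e = -1\<close> its formal adjoint. A vector \<open>fb\<close> outside \<open>I\<^sub>q\<close> is \<open>0\<close>
  and in addition has coefficient \<open>0\<close>; the latter is what makes the relations below hold at the
  boundary.\<close>

definition ladder :: "int \<Rightarrow> lab \<Rightarrow> lab ell2"
  where "ladder e = (\<lambda>(m, p, t). inverse (q - inverse q) *\<^sub>R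
    (t_coeff e (m, p, t) *\<^sub>R fb q (m - e) p (t * q powi - e) + p_coeff e (m, p, t) *\<^sub>R fb q (m - e) (q powi e * p) t))"

definition slice_z :: "real \<Rightarrow> int \<Rightarrow> real \<Rightarrow> real \<Rightarrow> real \<Rightarrow> real \<Rightarrow> real"
  where "slice_z p1 m2 p2 t2 w y = sgn (p2 * t2) * p1 * w / (y * q powi m2)"

text \<open>The part of \<open>W\<^sup>*(f\<^sub>1 \<otimes> f\<^sub>2)\<close> with second label \<open>(m, w, y)\<close>; \<open>slice_z\<close> solves
  \<open>w = sgn(p\<^sub>2t\<^sub>2)yzq\<^bsup>m\<^sub>2\<^esup>/p\<^sub>1\<close> for \<open>z\<close>.\<close>

definition slice :: "lab \<Rightarrow> lab \<Rightarrow> lab \<Rightarrow> lab ell2"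
  where "slice = (\<lambda>(m1, p1, t1) (m2, p2, t2) (m, w, y). let z = slice_z p1 m2 p2 t2 w y in
    if w \<in> Iq q \<and> y \<in> Iq q \<and> m = chi q (p1 * p2 / (t2 * z))
    then (\<bar>t2 / y\<bar> * a_fun q t2 p1 y * a_fun q p2 z w) *\<^sub>R fb q (m1 + m2 - m) z t1 else 0)"

lemma slice_z_iff:
  assumes "p1 \<in> Iq q" "p2 \<in> Iq q" "t2 \<in> Iq q" "y \<in> Iq q"
  shows "w = sgn (p2 * t2) * y * z * q powi m2 / p1 \<longleftrightarrow> z = slice_z p1 m2 p2 t2 w y"
proof -
  have nz: "p1 \<noteq> 0" "p2 \<noteq> 0" "t2 \<noteq> 0" "y \<noteq> 0"
    using assms Iq_subset_lattice[OF q] lattice_nonzero[OF q] by auto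
  define s where "s = sgn (p2 * t2)"
  have s: "s = 1 \<or> s = -1" using nz by (auto simp: s_def sgn_if)
  have "q powi m2 \<noteq> 0" using q by simp
  then show ?thesis
    unfolding slice_z_def s_def[symmetric] using nz s by (auto simp: field_simps)
qed

text \<open>Evaluating a coordinate is bounded, so it passes through the infinite sum. A second
  label \<open>(m, w, y)\<close> shows \<open>y\<close> and, through \<open>slice_z_iff\<close>,
  determines \<open>z\<close>; thus at most one summand survives.\<close>

lemma is_W_slice:
  assumes W: "is_W q W" and I: "p1 \<in> Iq q" "t1 \<in> Iq q" "p2 \<in> Iq q" "t2 \<in> Iq q"
  obtains \<psi> where "(fb q m1 p1 t1 \<otimes>\<^sub>v fb q m2 p2 t2, \<psi>) \<in> adj (\<K>\<K> q) W"
    "\<And>i j. coord \<psi> (i, j) = coord (slice (m1, p1, t1) (m2, p2, t2) j) i"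
proof -
  define S where "S = {(y, z). y \<in> Iq q \<and> z \<in> Iq q \<and> sgn (p2 * t2) * y * z * q powi m2 / p1 \<in> Iq q}"
  define f where "f = (\<lambda>(y, z). (\<bar>t2 / y\<bar> * a_fun q t2 p1 y *
              a_fun q p2 z (sgn (p2 * t2) * y * z * q powi m2 / p1)) *\<^sub>R
            (fb q (m1 + m2 - chi q (p1 * p2 / (t2 * z))) z t1 \<otimes>\<^sub>v
             fb q (chi q (p1 * p2 / (t2 * z))) (sgn (p2 * t2) * y * z * q powi m2 / p1) y))"
  obtain \<psi> where \<psi>: "(fb q m1 p1 t1 \<otimes>\<^sub>v fb q m2 p2 t2, \<psi>) \<in> adj (\<K>\<K> q) W" "(f has_sum \<psi>) S"
    using W I unfolding is_W_def f_def S_def by blast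
  have "coord \<psi> (i, (m, w, y)) = coord (slice (m1, p1, t1) (m2, p2, t2) (m, w, y)) i" for i m w y
  proof -
    define z where "z = slice_z p1 m2 p2 t2 w y"
    have h: "((\<lambda>x. coord (f x) (i, (m, w, y))) has_sum coord \<psi> (i, (m, w, y))) S"
      using has_sum_bounded_linear[OF bounded_linear_coord \<psi>(2)] by (simp add: o_def)
    have z0: "coord (f x) (i, (m, w, y)) = 0" if "x \<in> S" "x \<noteq> (y, z)" for x
      using that slice_z_iff[OF I(1,3,4), of y w] unfolding f_def S_def z_def
      by (auto simp: coord_simps coord_tensor coord_fb split: prod.splits)
    show ?thesis
    proof (cases "(y, z) \<in> S")
      case True
      have "((\<lambda>x. coord (f x) (i, (m, w, y))) has_sum coord (f (y, z)) (i, (m, w, y))) {(y, z)}"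
        using has_sum_finite[of "{(y, z)}"] by simp
      then have "((\<lambda>x. coord (f x) (i, (m, w, y))) has_sum coord (f (y, z)) (i, (m, w, y))) S"
        by (rule has_sum_cong_neutral[THEN iffD1, rotated -1]) (use z0 True in auto)
      then have "coord \<psi> (i, (m, w, y)) = coord (f (y, z)) (i, (m, w, y))"
        using h has_sum_unique by blast
      moreover have "y \<in> Iq q" using True by (simp add: S_def)
      moreover have w: "sgn (p2 * t2) * y * z * q powi m2 / p1 = w"
        by (rule slice_z_iff[OF I(1,3,4) \<open>y \<in> Iq q\<close>, THEN iffD2, OF z_def, symmetric])
      moreover have "z \<in> Iq q" "w \<in> Iq q" using True unfolding S_def w[symmetric] by auto
      ultimately show ?thesis
        using I by (simp add: f_def slice_def Let_def z_def[symmetric] coord_simps coord_tensor coord_fb)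
    next
      case False
      have "((\<lambda>x. coord (f x) (i, (m, w, y))) has_sum 0) S"
        by (rule has_sum_0) (use z0 False in blast)
      then have "coord \<psi> (i, (m, w, y)) = 0"
        using h has_sum_unique by blast
      \<comment> \<open>With \<open>w\<close> and \<open>y\<close> in \<open>Iq q\<close> the pair
        \<open>(y, z)\<close> can only be missing from the index set because of \<open>z\<close>,
        and then \<open>fb\<close> makes the slice zero as well.\<close>
      moreover have "z \<notin> Iq q" if "w \<in> Iq q" "y \<in> Iq q"
        using False that slice_z_iff[OF I(1,3,4) that(2), of w z m2] unfolding S_def z_def by auto
      then have "coord (slice (m1, p1, t1) (m2, p2, t2) (m, w, y)) i = 0"
        by (auto simp: slice_def Let_def z_def[symmetric] coord_simps coord_fb)
      ultimately show ?thesis by simp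
    qed
  qed
  then show ?thesis using that \<psi>(1) by (metis surj_pair)
qed

text \<open>The eigenvalue depends on \<open>m\<close> and on the logarithms of the other labels
  only. Since \<open>m + chi q z = chi q p1 + chi q p2 - chi q t2\<close>, both \<open>m\<close> and
  \<open>z\<close> drop out of the exponent.\<close>

lemma slice_support:
  assumes I: "p1 \<in> Iq q" "t1 \<in> Iq q" "p2 \<in> Iq q" "t2 \<in> Iq q"
    and "coord (slice (m1, p1, t1) (m2, p2, t2) j) i \<noteq> 0"
  shows "K_eigen i = K_eigen (m1, p1, t1) * K_eigen (m2, p2, t2)" "i \<in> labels q" "j \<in> labels q"
proof -
  obtain m w y where j: "j = (m, w, y)" by (cases j)
  define z where "z = slice_z p1 m2 p2 t2 w y"
  have w: "w \<in> Iq q" "y \<in> Iq q" "m = chi q (p1 * p2 / (t2 * z))" "z \<in> Iq q" "i = (m1 + m2 - m, z, t1)"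
    using assms(5)
    by (auto simp: j slice_def Let_def z_def[symmetric] coord_simps coord_fb split: if_splits)
  note l = I[THEN Iq_subset_lattice[OF q]] w(4)[THEN Iq_subset_lattice[OF q]]
  have m: "m = chi q p1 + chi q p2 - (chi q t2 + chi q z)"
    unfolding w(3) using l by (simp add: chi_mult[OF q] chi_divide[OF q] lattice_mult[OF q])
  show "K_eigen i = K_eigen (m1, p1, t1) * K_eigen (m2, p2, t2)"
    unfolding w(5) K_eigen_def prod.case abs_divide_powr[OF l(5,2)] abs_divide_powr[OF l(1,2)]
      abs_divide_powr[OF l(3,4)] powr_add[symmetric]
    by (rule arg_cong[where f = "(powr) q"]) (simp add: m field_simps)
  show "i \<in> labels q" "j \<in> labels q" using w I by (auto simp: labels_def j)
qed

text \<open>The coefficient of the basis vector with middle label \<open>z\<close>. On the left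
  \<open>E \<otimes> 1\<close> reaches it from \<open>z * q powi - e\<close>; on the right it comes
  from shifting \<open>p1\<close>, \<open>t2\<close> or \<open>p2\<close>. The label
  \<open>z * q powi - e\<close> need not lie in \<open>Iq q\<close>, which the boundary case relies
  on.\<close>

lemma p_coeff_K_eigen:
  assumes I: "p1 \<in> Iq q" "t1 \<in> Iq q" "p2 \<in> Iq q" "t2 \<in> Iq q" "y \<in> Iq q" "z \<in> Iq q" "w \<in> Iq q"
    and e: "e \<in> {1, -1}" and z: "z * q powi - e = slice_z p1 m2 p2 t2 w y"
  shows "\<bar>t2 / y\<bar> * a_fun q t2 p1 y * a_fun q p2 (z * q powi - e) w
      * p_coeff e (m1 + m2 - chi q (p1 * p2 / (t2 * (z * q powi - e))), z * q powi - e, t1)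
    = p_coeff e (m1, p1, t1) * K_eigen (m2, p2, t2)
        * (\<bar>t2 / y\<bar> * a_fun q t2 (q powi e * p1) y * a_fun q p2 z w)
      + inverse (K_eigen (m1, p1, t1)) * t_coeff e (m2, p2, t2)
        * (\<bar>t2 * q powi - e / y\<bar> * a_fun q (t2 * q powi - e) p1 y * a_fun q p2 z w)
      + inverse (K_eigen (m1, p1, t1)) * p_coeff e (m2, p2, t2)
        * (\<bar>t2 / y\<bar> * a_fun q t2 p1 y * a_fun q (q powi e * p2) z w)"
proof -
  note l = I[THEN Iq_subset_lattice[OF q]]
  note lm = lattice_mult[OF q] lattice_divide[OF q] lattice_powi[OF q]
  note nz = l[THEN lattice_nonzero[OF q]]
  have cq: "chi q (q powi k) = k" for k using q by (intro chi_powi[OF q]) simp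
  note ch = chi_mult[OF q] chi_divide[OF q] cq
  \<comment> \<open>The hypothesis on \<open>z\<close> enters only here; it ties the exponent of
    \<open>w\<close> to the others and makes the two right-hand sides match.\<close>
  have aw: "chi q w = chi q y + chi q z - e + m2 - chi q p1"
  proof -
    have "w = sgn (p2 * t2) * y * (z * q powi - e) * q powi m2 / p1"
      by (rule slice_z_iff[THEN iffD2, OF I(1,3,4,5) z])
    then have "\<bar>w\<bar> = \<bar>y * (z * q powi - e) * q powi m2 / p1\<bar>"
      using nz by (simp add: abs_mult abs_sgn_eq)
    then have "chi q w = chi q (y * (z * q powi - e) * q powi m2 / p1)"
      by (simp add: chi_def)
    then show ?thesis using l by (simp add: ch lm)
  qed
  \<comment> \<open>\<open>F\<close> and \<open>G\<close> are the common factors of the first and the second three-term relation.\<close>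
  define F where "F = q powr ((real_of_int (m1 - e - m2) + real_of_int (chi q t1 - chi q p1 + chi q p2 - chi q t2)) / 2)"
  define G where "G = q powr ((real_of_int (m1 - e + m2) + real_of_int (chi q t1 - chi q p1 + chi q t2 - chi q p2)) / 2)"
  note d = abs_divide_powr
  have z0: "z * q powi - e \<in> lattice q" using l by (simp add: lm)
  have z0': "shift_root (- e) (z * q powi - e) = shift_root e z" "sgn (z * q powi - e) = sgn z"
    using e q by (auto simp: shift_root_def power_int_minus divide_inverse sgn_mult mult.assoc)
  have "F = q powr (real_of_int (m1 - e) / 2) * q powr (real_of_int (chi q t1 - chi q p1) / 2)
      * (q powr (- real_of_int m2 / 2) * q powr (real_of_int (chi q p2 - chi q t2) / 2))"
    unfolding F_def powr_add[symmetric]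
    by (rule arg_cong[where f = "(powr) q"]) (simp add: field_simps)
  then have 1: "p_coeff e (m1, p1, t1) * K_eigen (m2, p2, t2) = - (sgn p1 * shift_root (- e) p1) * F"
    unfolding p_coeff_def K_eigen_def prod.case d[OF l(2,1)] d[OF l(3,4)]
    by (simp only: mult_ac mult_minus_left mult_minus_right)
  have "F = inverse (q powr (- real_of_int m1 / 2) * q powr (real_of_int (chi q p1 - chi q t1) / 2))
      * (q powr (- real_of_int (m2 - e) / 2) * q powr (real_of_int (chi q p2 - chi q t2) / 2)) * q powi - e"
    unfolding F_def powr_add[symmetric] powr_minus[symmetric] powi_powr
    by (rule arg_cong[where f = "(powr) q"]) (simp add: field_simps)
  then have 2: "inverse (K_eigen (m1, p1, t1)) * t_coeff e (m2, p2, t2) * q powi - e = sgn t2 * shift_root e t2 * F"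
    unfolding t_coeff_def K_eigen_def prod.case d[OF l(1,2)] d[OF l(3,4)] by (simp only: mult_ac)
  have "G = inverse (q powr (- real_of_int m1 / 2) * q powr (real_of_int (chi q p1 - chi q t1) / 2))
      * (q powr (real_of_int (m2 - e) / 2) * q powr (real_of_int (chi q t2 - chi q p2) / 2))"
    unfolding G_def powr_add[symmetric] powr_minus[symmetric]
    by (rule arg_cong[where f = "(powr) q"]) (simp add: field_simps)
  then have 3: "inverse (K_eigen (m1, p1, t1)) * p_coeff e (m2, p2, t2) = - (sgn p2 * shift_root (- e) p2) * G"
    unfolding p_coeff_def K_eigen_def prod.case d[OF l(1,2)] d[OF l(4,3)]
    by (simp only: mult_ac mult_minus_left mult_minus_right)
  have "G = q powr (real_of_int (m1 + m2 - chi q (p1 * p2 / (t2 * (z * q powi - e))) - e) / 2)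
      * q powr (real_of_int (chi q t1 - chi q (z * q powi - e)) / 2)"
    unfolding G_def powr_add[symmetric]
    by (rule arg_cong[where f = "(powr) q"]) (use l in \<open>simp add: ch lm field_simps\<close>)
  then have 4: "p_coeff e (m1 + m2 - chi q (p1 * p2 / (t2 * (z * q powi - e))), z * q powi - e, t1)
      = - (sgn z * shift_root e z) * G"
    unfolding p_coeff_def prod.case d[OF l(2) z0] z0'
    by (simp only: mult_ac mult_minus_left mult_minus_right)
  have "\<bar>p1 * t2 / y\<bar> = q powr real_of_int (chi q p1 + chi q t2 - chi q y)"
    "\<bar>z * p2 / w\<bar> = q powr real_of_int (chi q z + chi q p2 - chi q w)"
    using l abs_chi[of "p1 * t2 / y"] abs_chi[of "z * p2 / w"] by (simp_all add: ch lm)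
  \<comment> \<open>The cancellation: both relations yield multiples of
    \<open>a_fun q t2 p1 y * a_fun q p2 z w\<close>, and these are the two multiples.\<close>
  then have 5: "F * (\<bar>p1 * t2 / y\<bar> * q powr (real_of_int (e - 1) / 2))
      = G * (\<bar>z * p2 / w\<bar> * q powr (real_of_int (- e - 1) / 2))"
    by (simp only: F_def G_def powr_add[symmetric] aw)
      (rule arg_cong[where f = "(powr) q"], simp add: field_simps)
  have R1: "sgn t2 * shift_root e t2 * a_fun q (t2 * q powi - e) p1 y
      - sgn p1 * shift_root (- e) p1 * a_fun q t2 (q powi e * p1) y
    = - (\<bar>p1 * t2 / y\<bar> * q powr (real_of_int (e - 1) / 2)) * a_fun q t2 p1 y"
    by (rule a_fun_contiguous[OF e I(4,1,5)])
  \<comment> \<open>The sign \<open>e\<close> is reversed because \<open>p2\<close> plays the part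
    of the lower index here, while \<open>E\<close> moves \<open>p\<close> and \<open>t\<close>
    oppositely.\<close>
  have R2: "sgn p2 * shift_root (- e) p2 * a_fun q (q powi e * p2) z w
      - sgn z * shift_root e z * a_fun q p2 (z * q powi - e) w
    = - (\<bar>z * p2 / w\<bar> * q powr (real_of_int (- e - 1) / 2)) * a_fun q p2 z w"
    using a_fun_contiguous[of "- e" p2 z w] e I by (auto simp: mult.commute)
  have "\<bar>t2 * q powi - e / y\<bar> = q powi - e * \<bar>t2 / y\<bar>" using q by (simp add: abs_mult)
  then have "inverse (K_eigen (m1, p1, t1)) * t_coeff e (m2, p2, t2)
        * (\<bar>t2 * q powi - e / y\<bar> * a_fun q (t2 * q powi - e) p1 y * a_fun q p2 z w)
      = (inverse (K_eigen (m1, p1, t1)) * t_coeff e (m2, p2, t2) * q powi - e)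
        * (\<bar>t2 / y\<bar> * a_fun q (t2 * q powi - e) p1 y * a_fun q p2 z w)"
    by (simp only: mult_ac)
  also have "\<dots> = F * \<bar>t2 / y\<bar> * a_fun q p2 z w * (sgn t2 * shift_root e t2 * a_fun q (t2 * q powi - e) p1 y)"
    unfolding 2 by (simp only: mult_ac)
  also have "sgn t2 * shift_root e t2 * a_fun q (t2 * q powi - e) p1 y
      = sgn p1 * shift_root (- e) p1 * a_fun q t2 (q powi e * p1) y
    - (\<bar>p1 * t2 / y\<bar> * q powr (real_of_int (e - 1) / 2)) * a_fun q t2 p1 y"
    using R1 by (simp only: diff_eq_eq mult_minus_left uminus_add_conv_diff)
  also have "F * \<bar>t2 / y\<bar> * a_fun q p2 z w * (sgn p1 * shift_root (- e) p1 * a_fun q t2 (q powi e * p1) y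
    - (\<bar>p1 * t2 / y\<bar> * q powr (real_of_int (e - 1) / 2)) * a_fun q t2 p1 y)
    = F * \<bar>t2 / y\<bar> * a_fun q p2 z w * (sgn p1 * shift_root (- e) p1 * a_fun q t2 (q powi e * p1) y)
    - (F * (\<bar>p1 * t2 / y\<bar> * q powr (real_of_int (e - 1) / 2))) * \<bar>t2 / y\<bar> * a_fun q p2 z w * a_fun q t2 p1 y"
    by (simp only: right_diff_distrib mult_ac)
  also have "\<dots> = F * \<bar>t2 / y\<bar> * a_fun q p2 z w * (sgn p1 * shift_root (- e) p1 * a_fun q t2 (q powi e * p1) y)
    + G * \<bar>t2 / y\<bar> * a_fun q t2 p1 y
      * (- (\<bar>z * p2 / w\<bar> * q powr (real_of_int (- e - 1) / 2)) * a_fun q p2 z w)"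
    unfolding 5 by (simp add: algebra_simps)
  finally show ?thesis unfolding 1 3 4 R2[symmetric] by (simp add: algebra_simps)
qed

end

section \<open>Intertwining of the slices\<close>

context
  fixes q :: real
  assumes q: "0 < q" "q < 1"
begin

text \<open>Every slice keeps \<open>t1\<close>, so the two terms shifting \<open>t1\<close> agree
  by the exponent count of \<open>slice_support\<close>, without any relation for
  \<open>a_fun\<close>.\<close>

lemma t_coeff_K_eigen:
  assumes I: "p1 \<in> lattice q" "t1 \<in> lattice q" "p2 \<in> lattice q" "t2 \<in> lattice q" "z \<in> lattice q"
  shows "t_coeff q e (m1 + m2 - chi q (p1 * p2 / (t2 * z)), z, t1) = t_coeff q e (m1, p1, t1) * K_eigen q (m2, p2, t2)"
proof -
  note d = abs_divide_powr[OF q]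
  have "q powr (- real_of_int (m1 + m2 - chi q (p1 * p2 / (t2 * z)) - e) / 2)
      * q powr (real_of_int (chi q z - chi q t1) / 2)
    = q powr (- real_of_int (m1 - e) / 2) * q powr (real_of_int (chi q p1 - chi q t1) / 2)
      * (q powr (- real_of_int m2 / 2) * q powr (real_of_int (chi q p2 - chi q t2) / 2))"
    unfolding powr_add[symmetric] using I
    by (intro arg_cong[where f = "(powr) q"])
      (simp add: chi_mult[OF q] chi_divide[OF q] lattice_mult[OF q] field_simps)
  then have "sgn t1 * (q powr (- real_of_int (m1 + m2 - chi q (p1 * p2 / (t2 * z)) - e) / 2)
      * q powr (real_of_int (chi q z - chi q t1) / 2)) * shift_root q e t1
    = sgn t1 * (q powr (- real_of_int (m1 - e) / 2) * q powr (real_of_int (chi q p1 - chi q t1) / 2)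
      * (q powr (- real_of_int m2 / 2) * q powr (real_of_int (chi q p2 - chi q t2) / 2))) * shift_root q e t1"
    by (simp only:)
  then show ?thesis
    unfolding t_coeff_def[OF q] K_eigen_def[OF q] prod.case d[OF I(5,2)] d[OF I(1,2)] d[OF I(3,4)]
    by (simp only: mult_ac)
qed

text \<open>\<open>E \<otimes> K + K\<inverse> \<otimes> E\<close> on \<open>f\<^sub>1 \<otimes> f\<^sub>2\<close>, written out on basis labels. The function \<open>f\<close> is either the
  tensor product of the basis vectors or a slice of its image under \<open>W\<^sup>*\<close>.\<close>

definition ladder_comult :: "int \<Rightarrow> (lab \<Rightarrow> lab \<Rightarrow> 'b :: real_vector) \<Rightarrow> lab \<Rightarrow> lab \<Rightarrow> 'b"
  where "ladder_comult e f = (\<lambda>(m1, p1, t1) (m2, p2, t2). inverse (q - inverse q) *\<^sub>R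
    ((t_coeff q e (m1, p1, t1) * K_eigen q (m2, p2, t2)) *\<^sub>R f (m1 - e, p1, t1 * q powi - e) (m2, p2, t2)
    + (p_coeff q e (m1, p1, t1) * K_eigen q (m2, p2, t2)) *\<^sub>R f (m1 - e, q powi e * p1, t1) (m2, p2, t2)
    + (inverse (K_eigen q (m1, p1, t1)) * t_coeff q e (m2, p2, t2)) *\<^sub>R f (m1, p1, t1) (m2 - e, p2, t2 * q powi - e)
    + (inverse (K_eigen q (m1, p1, t1)) * p_coeff q e (m2, p2, t2)) *\<^sub>R f (m1, p1, t1) (m2 - e, q powi e * p2, t2)))"

text \<open>All five slices live under the same condition on \<open>j\<close>. Shifting
  \<open>p1\<close>, \<open>t2\<close> or \<open>p2\<close> replaces \<open>z0\<close> by
  \<open>z = q powi e * z0\<close> while the argument of \<open>chi\<close> is unchanged, so only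
  two basis vectors occur and two coefficients have to be compared.\<close>

lemma slice_ladder:
  assumes I: "p1 \<in> Iq q" "t1 \<in> Iq q" "p2 \<in> Iq q" "t2 \<in> Iq q" and e: "e \<in> {1, -1}"
  shows "(slice q (m1, p1, t1) (m2, p2, t2) j,
      ladder_comult e (\<lambda>l1 l2. slice q l1 l2 j) (m1, p1, t1) (m2, p2, t2)) \<in> basis_op (labels q) (ladder q e)"
proof -
  obtain m w y where j: "j = (m, w, y)" by (cases j)
  note B = subspace_cgraphD[OF subspace_basis_op[of "labels q" "ladder q e"]]
  define z0 where "z0 = slice_z q p1 m2 p2 t2 w y"
  define z where "z = q powi e * z0"
  define n where "n = m1 + m2 - m"
  have qe: "q powi e \<noteq> 0" "q powi - e * q powi e = 1" using q by (auto simp: power_int_minus)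
  have zz0: "z * q powi - e = z0" using qe by (simp add: z_def mult_ac)
  have s: "sgn (q powi - e) = 1" "sgn (q powi e) = 1" using q by auto
  have pe: "q powi (m2 - e) = q powi m2 * q powi - e"
    using q power_int_add[of q m2 "- e"] by simp
  have z: "slice_z q (q powi e * p1) m2 p2 t2 w y = z"
    "slice_z q p1 (m2 - e) p2 (t2 * q powi - e) w y = z"
    "slice_z q p1 (m2 - e) (q powi e * p2) t2 w y = z"
    using qe q by (simp_all add: slice_z_def[OF q] z_def z0_def sgn_mult s pe power_int_minus field_simps)
  have c: "q powi e * p1 * p2 / (t2 * z) = p1 * p2 / (t2 * z0)"
    "p1 * p2 / (t2 * q powi - e * z) = p1 * p2 / (t2 * z0)"
    "p1 * (q powi e * p2) / (t2 * z) = p1 * p2 / (t2 * z0)"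
    using qe q by (simp_all add: z_def power_int_minus field_simps)
  show ?thesis
  proof (cases "w \<in> Iq q \<and> y \<in> Iq q \<and> m = chi q (p1 * p2 / (t2 * z0))")
    case False
    then have "slice q (m1, p1, t1) (m2, p2, t2) j = 0"
      "slice q (m1 - e, p1, t1 * q powi - e) (m2, p2, t2) j = 0"
      "slice q (m1 - e, q powi e * p1, t1) (m2, p2, t2) j = 0"
      "slice q (m1, p1, t1) (m2 - e, p2, t2 * q powi - e) j = 0"
      "slice q (m1, p1, t1) (m2 - e, q powi e * p2, t2) j = 0"
      unfolding slice_def[OF q] j prod.case Let_def z c z0_def[symmetric] by (simp_all only: if_False)
    then show ?thesis using B(1) by (simp add: ladder_comult_def)
  next
    case True
    then have w: "w \<in> Iq q" "y \<in> Iq q" and m: "m = chi q (p1 * p2 / (t2 * z0))" by auto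
    define c0 where "c0 = \<bar>t2 / y\<bar> * a_fun q t2 p1 y * a_fun q p2 z0 w"
    have n: "m1 - e + m2 - m = n - e" "m1 + (m2 - e) - m = n - e" by (simp_all add: n_def)
    have S: "slice q (m1, p1, t1) (m2, p2, t2) j = c0 *\<^sub>R fb q n z0 t1"
      "slice q (m1 - e, p1, t1 * q powi - e) (m2, p2, t2) j = c0 *\<^sub>R fb q (n - e) z0 (t1 * q powi - e)"
      "slice q (m1 - e, q powi e * p1, t1) (m2, p2, t2) j
        = (\<bar>t2 / y\<bar> * a_fun q t2 (q powi e * p1) y * a_fun q p2 z w) *\<^sub>R fb q (n - e) z t1"
      "slice q (m1, p1, t1) (m2 - e, p2, t2 * q powi - e) j
        = (\<bar>t2 * q powi - e / y\<bar> * a_fun q (t2 * q powi - e) p1 y * a_fun q p2 z w) *\<^sub>R fb q (n - e) z t1"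
      "slice q (m1, p1, t1) (m2 - e, q powi e * p2, t2) j
        = (\<bar>t2 / y\<bar> * a_fun q t2 p1 y * a_fun q (q powi e * p2) z w) *\<^sub>R fb q (n - e) z t1"
      unfolding slice_def[OF q] j prod.case Let_def z c z0_def[symmetric] n c0_def
      using True by (simp_all only: n_def if_True simp_thms)
    have tc: "t_coeff q e (m1, p1, t1) * K_eigen q (m2, p2, t2) = t_coeff q e (n, z0, t1)" if "z0 \<in> Iq q"
      unfolding n_def m using t_coeff_K_eigen I that Iq_subset_lattice[OF q] by simp
    have pc: "p_coeff q e (m1, p1, t1) * K_eigen q (m2, p2, t2)
        * (\<bar>t2 / y\<bar> * a_fun q t2 (q powi e * p1) y * a_fun q p2 z w)
      + inverse (K_eigen q (m1, p1, t1)) * t_coeff q e (m2, p2, t2)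
        * (\<bar>t2 * q powi - e / y\<bar> * a_fun q (t2 * q powi - e) p1 y * a_fun q p2 z w)
      + inverse (K_eigen q (m1, p1, t1)) * p_coeff q e (m2, p2, t2)
        * (\<bar>t2 / y\<bar> * a_fun q t2 p1 y * a_fun q (q powi e * p2) z w) = c0 * p_coeff q e (n, z0, t1)"
      if "z \<in> Iq q"
      using p_coeff_K_eigen[OF q I w(2) that w(1) e, of m2 m1] unfolding zz0 c0_def n_def m z0_def by simp
    have eq: "ladder_comult e (\<lambda>l1 l2. slice q l1 l2 j) (m1, p1, t1) (m2, p2, t2)
      = inverse (q - inverse q) *\<^sub>R ((t_coeff q e (m1, p1, t1) * K_eigen q (m2, p2, t2) * c0) *\<^sub>R
          fb q (n - e) z0 (t1 * q powi - e)
        + (p_coeff q e (m1, p1, t1) * K_eigen q (m2, p2, t2)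
            * (\<bar>t2 / y\<bar> * a_fun q t2 (q powi e * p1) y * a_fun q p2 z w)
          + inverse (K_eigen q (m1, p1, t1)) * t_coeff q e (m2, p2, t2)
            * (\<bar>t2 * q powi - e / y\<bar> * a_fun q (t2 * q powi - e) p1 y * a_fun q p2 z w)
          + inverse (K_eigen q (m1, p1, t1)) * p_coeff q e (m2, p2, t2)
            * (\<bar>t2 / y\<bar> * a_fun q t2 p1 y * a_fun q (q powi e * p2) z w)) *\<^sub>R fb q (n - e) z t1)"
      unfolding ladder_comult_def prod.case S by (simp only: scaleR_scaleR scaleR_add_left add.assoc)
    show ?thesis
    proof (cases "z0 \<in> Iq q")
      case z0: True
      have "ladder_comult e (\<lambda>l1 l2. slice q l1 l2 j) (m1, p1, t1) (m2, p2, t2)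
          = c0 *\<^sub>R ladder q e (n, z0, t1)"
      proof (cases "z \<in> Iq q")
        case True
        show ?thesis unfolding eq pc[OF True] tc[OF z0] ladder_def[OF q] prod.case z_def[symmetric]
          by (simp add: scaleR_right_distrib mult_ac)
      next
        case False
        then have "fb q (n - e) z t1 = 0" by (simp add: fb_def)
        then show ?thesis unfolding eq tc[OF z0] ladder_def[OF q] prod.case z_def[symmetric]
          by (simp add: scaleR_right_distrib mult_ac)
      qed
      moreover have lab: "(n, z0, t1) \<in> labels q" using z0 I by (simp add: labels_def)
      ultimately show ?thesis
        using B(3)[OF basis_op_base[OF lab, of "ladder q e"], of "complex_of_real c0"]
        unfolding S(1) by (simp add: scaleR_ell2_def fb_labels)
    next
      case False
      then have f: "fb q n z0 t1 = 0" "fb q (n - e) z0 (t1 * q powi - e) = 0" by (simp_all add: fb_def)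
      \<comment> \<open>The slice itself is zero here, so its image must be too. If \<open>z\<close>
        is in \<open>Iq q\<close> while its neighbour \<open>z0\<close> is not, the weight of the
        step between them vanishes.\<close>
      have "p_coeff q e (n, z0, t1) = 0" if "z \<in> Iq q"
      proof -
        have "shift_root q e z = 0" using Iq_shift[OF q e that] False zz0 by simp
        moreover have "shift_root q (- e) z0 = shift_root q e z"
          using e q by (auto simp: shift_root_def[OF q] z_def power_int_minus field_simps)
        ultimately show ?thesis by (simp add: p_coeff_def[OF q])
      qed
      then have "ladder_comult e (\<lambda>l1 l2. slice q l1 l2 j) (m1, p1, t1) (m2, p2, t2) = 0"
        unfolding eq f using pc by (cases "z \<in> Iq q") (simp_all add: fb_def)
      then show ?thesis unfolding S(1) f using B(1) by simp
    qed
  qed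
qed


section \<open>\<open>K0\<close>, \<open>E0\<close> and the formal adjoint as operators given on
  basis vectors\<close>

lemma K0_eq: "K0 q = basis_op (labels q) (\<lambda>x. scaleC (complex_of_real (K_eigen q x)) (ket x))"
  unfolding K0_def basis_op_def K_eigen_def[OF q]
  by (rule arg_cong[where f = cgraph.span]) (force simp: labels_def fb_def scaleR_ell2_def)

lemma K_op_eq: "K_op q = mult_op (labels q) (\<lambda>x. complex_of_real (K_eigen q x))"
  unfolding K_op_def K0_eq by (rule closure_basis_op_scale)

lemma K_eigen_pos: "x \<in> labels q \<Longrightarrow> K_eigen q x > 0"
  using q lattice_nonzero[OF q] Iq_subset_lattice[OF q]
  by (auto simp: K_eigen_def[OF q] labels_def intro!: mult_pos_pos)

lemma K0_converse_subset:
  "(K0 q)\<inverse> \<subseteq> basis_op (labels q) (\<lambda>x. scaleC (complex_of_real (inverse (K_eigen q x))) (ket x))" (is "_ \<subseteq> ?R")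
proof -
  note B = subspace_cgraphD[OF subspace_basis_op[of "labels q"
    "\<lambda>x. scaleC (complex_of_real (inverse (K_eigen q x))) (ket x)"]]
  have "K0 q \<subseteq> {(v, v'). (v', v) \<in> ?R}"
    unfolding K0_eq
  proof (rule basis_op_minimal[OF subspace_cgraphI])
    fix x assume x: "x \<in> labels q"
    have "(scaleC (complex_of_real (K_eigen q x)) (ket x),
        scaleC (complex_of_real (K_eigen q x)) (scaleC (complex_of_real (inverse (K_eigen q x))) (ket x))) \<in> ?R"
      by (rule B(3)) (rule basis_op_base[OF x])
    then show "(ket x, scaleC (complex_of_real (K_eigen q x)) (ket x)) \<in> {(v, v'). (v', v) \<in> ?R}"
      using K_eigen_pos[OF x] by (simp add: of_real_mult[symmetric] del: of_real_mult)
  qed (use B in auto)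
  then show ?thesis by auto
qed

lemma E0_eq: "E0 q = basis_op (labels q) (ladder q 1)"
proof -
  have "ladder q 1 (m, p, t) = inverse (q - inverse q) *\<^sub>R
        ((sgn t * q powr (- real_of_int (m - 1) / 2) * \<bar>p / t\<bar> powr (1/2) * sqrt (1 + kappa (t / q)))
            *\<^sub>R fb q (m - 1) p (t / q)
         - (sgn p * q powr (real_of_int (m - 1) / 2) * \<bar>t / p\<bar> powr (1/2) * sqrt (1 + kappa p))
            *\<^sub>R fb q (m - 1) (q * p) t)" for m p t
  proof -
    have "t * q powi - 1 = t / q" "q powi 1 * p = q * p"
      using q by (simp_all add: power_int_minus field_simps)
    moreover have "shift_root q 1 t = sqrt (1 + kappa (t / q))" "shift_root q (- 1) p = sqrt (1 + kappa p)"
      by (simp_all add: shift_root_def[OF q])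
    ultimately show ?thesis
      unfolding ladder_def[OF q] t_coeff_def[OF q] p_coeff_def[OF q] prod.case
      by (simp only: scaleR_minus_left diff_conv_add_uminus)
  qed
  note eq = this
  have "{(fb q m p t, ladder q 1 (m, p, t)) | m p t. p \<in> Iq q \<and> t \<in> Iq q}
      = {(ket x, ladder q 1 x) | x. x \<in> labels q}"
    by (force simp: labels_def fb_def)
  then show ?thesis
    unfolding E0_def basis_op_def by (simp only: eq)
qed

lemma coord_ladder: "coord (ladder q e (m, p, t)) (m', p', t')
  = complex_of_real (inverse (q - inverse q) *
    ((if p \<in> Iq q \<and> t' \<in> Iq q \<and> m' = m - e \<and> p' = p \<and> t' = t * q powi - e then t_coeff q e (m, p, t) else 0)
    + (if p' \<in> Iq q \<and> t \<in> Iq q \<and> m' = m - e \<and> p' = q powi e * p \<and> t' = t then p_coeff q e (m, p, t) else 0)))"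
  unfolding ladder_def[OF q] prod.case by (auto simp: coord_simps coord_fb)

text \<open>The entries are real, so this is a transposition: a coefficient for \<open>e = 1\<close>
  at the shifted label equals the one for \<open>e = -1\<close> at the original label.\<close>

lemma ladder_adjoint:
  assumes "x \<in> labels q" "y \<in> labels q"
  shows "cnj (coord (ladder q 1 x) y) = coord (ladder q (-1) y) x"
proof -
  obtain m p t m' p' t' where xy: "x = (m, p, t)" "y = (m', p', t')" by (cases x, cases y)
  have I: "p \<in> Iq q" "t \<in> Iq q" "p' \<in> Iq q" "t' \<in> Iq q" using assms by (auto simp: labels_def xy)
  note l = I[THEN Iq_subset_lattice[OF q]] lattice_q[OF q]
  note d = abs_divide_powr[OF q]
  have q1: "q powi - 1 = inverse q" "q powi 1 = q" "q powi - (- 1) = q" using q by (simp_all add: power_int_minus)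
  have eq: "t' = t * inverse q \<longleftrightarrow> t = t' * q" "p' = q * p \<longleftrightarrow> p = inverse q * p'" "m' = m - 1 \<longleftrightarrow> m = m' + 1"
    using q by (auto simp: field_simps)
  have 1: "t_coeff q 1 (m' + 1, p', t' * q) = t_coeff q (-1) (m', p', t')"
  proof -
    have "q powr (- real_of_int (m' + 1 - 1) / 2) * q powr (real_of_int (chi q p' - chi q (t' * q)) / 2)
        = q powr (- real_of_int (m' - (-1)) / 2) * q powr (real_of_int (chi q p' - chi q t') / 2)"
      unfolding powr_add[symmetric] using l
      by (intro arg_cong[where f = "(powr) q"]) (simp add: chi_mult[OF q] chi_q[OF q] field_simps)
    then have "sgn t' * (q powr (- real_of_int (m' + 1 - 1) / 2) * q powr (real_of_int (chi q p' - chi q (t' * q)) / 2))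
        * sqrt (1 + kappa t')
        = sgn t' * (q powr (- real_of_int (m' - (-1)) / 2) * q powr (real_of_int (chi q p' - chi q t') / 2))
        * sqrt (1 + kappa t')" by (simp only:)
    moreover have "shift_root q 1 (t' * q) = sqrt (1 + kappa t')" "shift_root q (-1) t' = sqrt (1 + kappa t')"
      "sgn (t' * q) = sgn t'"
      using q by (simp_all add: shift_root_def[OF q] sgn_mult)
    ultimately show ?thesis
      unfolding t_coeff_def[OF q] prod.case d[OF l(3) lattice_mult[OF q l(4,5)]] d[OF l(3,4)]
      by (simp only: mult_ac)
  qed
  have 2: "p_coeff q 1 (m' + 1, inverse q * p', t') = p_coeff q (-1) (m', p', t')"
  proof -
    have ip: "inverse q * p' \<in> lattice q" "chi q (inverse q * p') = chi q p' - 1"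
      using lattice_divide[OF q l(3,5)] chi_divide[OF q l(3,5)] chi_q[OF q]
      by (simp_all add: field_simps)
    have "q powr (real_of_int (m' + 1 - 1) / 2) * q powr (real_of_int (chi q t' - chi q (inverse q * p')) / 2)
        = q powr (real_of_int (m' - (-1)) / 2) * q powr (real_of_int (chi q t' - chi q p') / 2)"
      unfolding powr_add[symmetric] ip(2)
      by (intro arg_cong[where f = "(powr) q"]) (simp add: field_simps)
    then have "sgn p' * (q powr (real_of_int (m' + 1 - 1) / 2) * q powr (real_of_int (chi q t' - chi q (inverse q * p')) / 2))
        * sqrt (1 + kappa (inverse q * p'))
        = sgn p' * (q powr (real_of_int (m' - (-1)) / 2) * q powr (real_of_int (chi q t' - chi q p') / 2))
        * sqrt (1 + kappa (inverse q * p'))" by (simp only:)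
    moreover have "shift_root q (- 1) (inverse q * p') = sqrt (1 + kappa (inverse q * p'))"
      "shift_root q (- (- 1)) p' = sqrt (1 + kappa (inverse q * p'))"
      "sgn (inverse q * p') = sgn p'"
      using q by (simp_all add: shift_root_def[OF q] sgn_mult field_simps)
    ultimately show ?thesis
      unfolding p_coeff_def[OF q] prod.case d[OF l(4) ip(1)] d[OF l(4,3)]
      by (simp only: mult_ac)
  qed
  show ?thesis
    unfolding xy coord_ladder q1 using I 1 2 by (auto simp: eq)
qed

text \<open>Pairing with \<open>ket i\<close> reads off the coordinates of \<open>w'\<close>, which
  are therefore given by the transposed matrix.\<close>

lemma E0_dag_subset: "E0_dag q \<subseteq> basis_op (labels q) (ladder q (-1))"
proof clarify
  fix w w' assume ww: "(w, w') \<in> E0_dag q"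
  have "w \<in> \<K>0 q" "w' \<in> \<K>0 q" using ww by (auto simp: E0_dag_def)
  define P where "P = {w. \<exists>A. finite A \<and> A \<subseteq> labels q \<and> (\<forall>x. x \<notin> A \<longrightarrow> coord w x = 0)}"
  have "\<K>0 q \<subseteq> P"
    unfolding \<K>0_def
  proof (rule cvec.span_minimal)
    show "{fb q m p t |m p t. p \<in> Iq q \<and> t \<in> Iq q} \<subseteq> P"
    proof clarify
      fix m p t assume "p \<in> Iq q" "t \<in> Iq q"
      then show "fb q m p t \<in> P" unfolding P_def
        by (auto intro!: exI[of _ "{(m, p, t)}"] simp: coord_fb labels_def)
    qed
    show "cvec.subspace P"
    proof (rule cvec.subspaceI)
      show "0 \<in> P" unfolding P_def by (auto intro!: exI[of _ "{}"] simp: coord_simps)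
      show "x + y \<in> P" if x: "x \<in> P" and y: "y \<in> P" for x y
      proof -
        obtain A where A: "finite A" "A \<subseteq> labels q" "\<forall>i. i \<notin> A \<longrightarrow> coord x i = 0"
          using x unfolding P_def by blast
        obtain B where B: "finite B" "B \<subseteq> labels q" "\<forall>i. i \<notin> B \<longrightarrow> coord y i = 0"
          using y unfolding P_def by blast
        have "\<forall>i. i \<notin> A \<union> B \<longrightarrow> coord (x + y) i = 0"
          unfolding coord_simps using A(3) B(3) by (metis UnI1 UnI2 add_0)
        moreover have "finite (A \<union> B)" "A \<union> B \<subseteq> labels q" using A B by auto
        ultimately show ?thesis unfolding P_def by blast
      qed
      show "scaleC c x \<in> P" if "x \<in> P" for c x
        using that unfolding P_def by (auto simp: coord_simps)
    qed
  qed
  then have wP: "w \<in> P" "w' \<in> P" using \<open>w \<in> \<K>0 q\<close> \<open>w' \<in> \<K>0 q\<close> by auto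
  from wP(1) obtain A where A: "finite A" "A \<subseteq> labels q" "\<forall>x. x \<notin> A \<longrightarrow> coord w x = 0"
    unfolding P_def mem_Collect_eq by (elim exE conjE)
  from wP(2) obtain B where B: "B \<subseteq> labels q" "\<forall>x. x \<notin> B \<longrightarrow> coord w' x = 0"
    unfolding P_def mem_Collect_eq by (elim exE conjE)
  have "w' = (\<Sum>x\<in>A. scaleC (coord w x) (ladder q (-1) x))"
  proof (rule ell2_eqI)
    fix i
    show "coord w' i = coord (\<Sum>x\<in>A. scaleC (coord w x) (ladder q (-1) x)) i"
    proof (cases "i \<in> labels q")
      case True
      have "(ket i, ladder q 1 i) \<in> E0 q" unfolding E0_eq by (rule basis_op_base[OF True])
      then have "cinner (ladder q 1 i) w = cinner (ket i) w'" using ww by (auto simp: E0_dag_def)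
      then have "coord w' i = cnj (cinner (ladder q 1 i) w)" by (simp add: cinner_ket_left)
      also have "\<dots> = (\<Sum>x\<in>A. coord w x * cnj (coord (ladder q 1 i) x))"
        using A by (subst cinner_finite[of A]) (auto simp: mult_ac)
      also have "\<dots> = (\<Sum>x\<in>A. coord w x * coord (ladder q (-1) x) i)"
        using A True by (intro sum.cong refl) (auto simp: ladder_adjoint)
      finally show ?thesis by (simp add: coord_sum coord_simps)
    next
      case False
      obtain m p t where i: "i = (m, p, t)" by (cases i)
      have "coord (ladder q (-1) x) i = 0" for x
        unfolding ladder_def[OF q] using False
        by (auto simp: coord_simps coord_fb labels_def i split: prod.splits)
      moreover have "coord w' i = 0" using B False by blast
      ultimately show ?thesis by (simp add: coord_sum coord_simps)
    qed
  qed
  then show "(w, w') \<in> basis_op (labels q) (ladder q (-1))"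
    using basis_opI[OF A(1,2), of w "ladder q (-1)"] A(3) by simp
qed

lemma ladder_in_\<K>: "ladder q e x \<in> \<K> q"
  by (cases x) (auto simp: ladder_def[OF q] \<K>_def supported_on_def coord_simps coord_fb labels_def)

text \<open>The adjoint is that of the closure. Since \<open>ladder q (-1) x\<close> has finite
  support, its adjoint relation involves finitely many coordinates; it is a closed linear condition
  and passes from \<open>E0\<close> to \<open>E_op\<close>.\<close>

lemma basis_op_ladder_subset_E_star: "basis_op (labels q) (ladder q (-1)) \<subseteq> E_star q"
  unfolding E_star_def
proof (rule basis_op_minimal)
  show "cgraph.subspace (adj (\<K> q) (E_op q))"
    unfolding \<K>_def by (rule subspace_adj[OF subspace_supported_on])
next
  fix x assume x: "x \<in> labels q"
  obtain m p t where xm: "x = (m, p, t)" by (cases x)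
  define A where "A = {(m + 1, p, t * q), (m + 1, inverse q * p, t)} \<inter> labels q"
  have A: "coord (ladder q (-1) x) i = 0" if "i \<notin> A" for i
    using that q unfolding A_def xm
    by (cases i) (auto simp: ladder_def[OF q] coord_simps coord_fb labels_def power_int_minus split: if_splits)
  have fin: "finite A" unfolding A_def by simp
  have ci: "cinner v (ladder q (-1) x) = (\<Sum>i\<in>A. coord v i * cnj (coord (ladder q (-1) x) i))" for v
    by (rule cinner_finite[OF fin]) (use A in blast)
  define C where "C = {z. coord (snd z) x = (\<Sum>i\<in>A. coord (fst z) i * cnj (coord (ladder q (-1) x) i))}"
  have "closed C" unfolding C_def by (intro closed_Collect_eq continuous_intros)
  moreover have "basis_op (labels q) (ladder q 1) \<subseteq> C"
  proof (rule basis_op_minimal)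
    show "cgraph.subspace C"
      by (rule subspace_cgraphI)
        (auto simp: C_def coord_simps sum.distrib distrib_right sum_distrib_left mult.assoc)
  next
    fix y assume y: "y \<in> labels q"
    have "(\<Sum>i\<in>A. coord (ket y) i * cnj (coord (ladder q (-1) x) i))
        = (if y \<in> A then cnj (coord (ladder q (-1) x) y) else 0)"
      using fin by (simp add: coord_ket if_distrib[of "\<lambda>c. c * _"] cong: if_cong)
    also have "\<dots> = cnj (coord (ladder q (-1) x) y)" using A[of y] by simp
    also have "\<dots> = coord (ladder q 1 y) x" using ladder_adjoint[OF y x, symmetric] by simp
    finally show "(ket y, ladder q 1 y) \<in> C" by (simp add: C_def)
  qed
  ultimately have "E_op q \<subseteq> C" unfolding E_op_def E0_eq by (rule closure_minimal[rotated])
  then have "\<forall>(v, v') \<in> E_op q. cinner v' (ket x) = cinner v (ladder q (-1) x)"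
    unfolding ci cinner_ket_right C_def by auto
  moreover have "ket x \<in> \<K> q" using x by (simp add: \<K>_def ket_in_supported_on)
  ultimately show "(ket x, ladder q (-1) x) \<in> adj (\<K> q) (E_op q)"
    using ladder_in_\<K> by (auto simp: adj_def)
qed

end

section \<open>The dual comultiplication\<close>

lift_definition swap_ell2 :: "('a \<times> 'b) ell2 \<Rightarrow> ('b \<times> 'a) ell2" is "\<lambda>f x. f (prod.swap x)"
proof -
  fix f :: "'a \<times> 'b \<Rightarrow> complex" assume "(\<lambda>i. (cmod (f i))\<^sup>2) summable_on UNIV"
  then show "(\<lambda>i. (cmod (f (prod.swap i)))\<^sup>2) summable_on UNIV"
    by (subst summable_on_reindex_bij_betw[of prod.swap UNIV UNIV "\<lambda>i. (cmod (f i))\<^sup>2"]) simp_all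
qed

lemma coord_swap: "coord (swap_ell2 v) (i, j) = coord v (j, i)"
  by (simp add: swap_ell2.rep_eq)

lemma flip_op_iff: "(v, w) \<in> flip_op q \<longleftrightarrow> v \<in> \<K>\<K> q \<and> w = swap_ell2 v"
proof -
  have "w = swap_ell2 v \<longleftrightarrow> (\<forall>i j. coord w (i, j) = coord v (j, i))"
    using ell2_eqI[of w "swap_ell2 v"] by (auto simp: coord_swap)
  then show ?thesis by (simp add: flip_op_def)
qed

lemma swap_swap: "swap_ell2 (swap_ell2 v) = v"
  by (rule ell2_eqI) (auto simp: coord_swap)

lemma swap_tensor: "swap_ell2 (v \<otimes>\<^sub>v w) = w \<otimes>\<^sub>v v"
  by (rule ell2_eqI) (auto simp: coord_swap coord_tensor)

lemma swap_add: "swap_ell2 (v + w) = swap_ell2 v + swap_ell2 w"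
  by (rule ell2_eqI) (auto simp: coord_swap coord_simps)

lemma swap_\<K>\<K>: "swap_ell2 v \<in> \<K>\<K> q \<longleftrightarrow> v \<in> \<K>\<K> q"
  by (auto simp: \<K>\<K>_def supported_on_def coord_swap)

lemma subspace_flip_op: "cgraph.subspace (flip_op q)"
  by (rule subspace_cgraphI) (auto simp: flip_op_def \<K>\<K>_def supported_on_def coord_simps)

lemma ket_\<K>\<K>: "x \<in> labels q \<times> labels q \<Longrightarrow> ket x \<in> \<K>\<K> q"
  by (simp add: \<K>\<K>_def ket_in_supported_on)

context
  fixes q :: real and W :: "(lab \<times> lab, lab \<times> lab) operator"
  assumes q: "0 < q" "q < 1" and W: "is_W q W"
begin

lemma unitary_W: "unitary_on (\<K>\<K> q) W"
  using W by (simp add: is_W_def)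

lemma adj_W: "adj (\<K>\<K> q) W = W\<inverse>"
  using adj_unitary_on unitary_W unfolding \<K>\<K>_def by blast

lemma W_in_\<K>\<K>: "(v, w) \<in> W \<Longrightarrow> v \<in> \<K>\<K> q \<and> w \<in> \<K>\<K> q"
  using unitary_W unfolding unitary_on_def by blast

lemma subspace_W: "cgraph.subspace W"
  using unitary_W by (simp add: unitary_on_def)

text \<open>The adjoint of \<open>W\<close> is its converse, so \<open>b\<close> and
  \<open>b'\<close> are the images under \<open>W\<^sup>*\<close> of the flipped \<open>v\<close>
  and \<open>w\<close>, and only \<open>W\<close> itself has to be mentioned.\<close>

lemma \<Delta>hat_iff: "(v, w) \<in> \<Delta>hat q W A \<longleftrightarrow> v \<in> \<K>\<K> q \<and>
    (\<exists>b b'. (b, swap_ell2 v) \<in> W \<and> (b, b') \<in> A \<otimes>\<^sub>o Id_on (\<K> q) \<and> (b', swap_ell2 w) \<in> W)"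
proof -
  have "(v, w) \<in> \<Delta>hat q W A \<longleftrightarrow> (\<exists>b b' a. (v, swap_ell2 v) \<in> flip_op q \<and> (b, swap_ell2 v) \<in> W
      \<and> (b, b') \<in> A \<otimes>\<^sub>o Id_on (\<K> q) \<and> (b', a) \<in> W \<and> (a, w) \<in> flip_op q)"
    unfolding \<Delta>hat_def adj_W by (auto simp: relcomp_unfold flip_op_iff)
  also have "\<dots> \<longleftrightarrow> v \<in> \<K>\<K> q \<and>
    (\<exists>b b'. (b, swap_ell2 v) \<in> W \<and> (b, b') \<in> A \<otimes>\<^sub>o Id_on (\<K> q) \<and> (b', swap_ell2 w) \<in> W)"
    using W_in_\<K>\<K> swap_swap unfolding flip_op_iff by metis
  finally show ?thesis .
qed

lemma subspace_\<Delta>hat: "cgraph.subspace (\<Delta>hat q W A)"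
proof -
  have "cgraph.subspace (W\<inverse>)"
    using subspace_cgraphD[OF subspace_W] by (intro subspace_cgraphI) auto
  then show ?thesis
    unfolding \<Delta>hat_def adj_W
    by (intro subspace_relcomp subspace_flip_op subspace_W subspace_closed_tensor)
qed

lemma W_slice:
  assumes "x \<in> labels q" "y \<in> labels q"
  obtains \<psi> where "(\<psi>, ket x \<otimes>\<^sub>v ket y) \<in> W" "\<And>i j. coord \<psi> (i, j) = coord (slice q x y j) i"
proof -
  obtain m1 p1 t1 m2 p2 t2 where xy: "x = (m1, p1, t1)" "y = (m2, p2, t2)" by (cases x, cases y)
  show ?thesis
    using is_W_slice[OF q W, of p1 t1 p2 t2 m1 m2] assms that
    unfolding adj_W by (auto simp: xy labels_def fb_def)
qed

definition fbl :: "lab \<Rightarrow> lab ell2"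
  where "fbl = (\<lambda>(m, p, t). fb q m p t)"

lemma fbl_labels: "x \<in> labels q \<Longrightarrow> fbl x = ket x"
  by (auto simp: fbl_def fb_def labels_def)

text \<open>A shifted label may leave \<open>labels q\<close>, but only with coefficient 0; the zero
  vector then serves as \<open>u\<close>.\<close>

lemma W_slice_scaled:
  assumes "x \<in> labels q \<and> y \<in> labels q \<or> c = 0"
  obtains u where "(u, c *\<^sub>R (fbl x \<otimes>\<^sub>v fbl y)) \<in> W"
    "\<And>i j. coord u (i, j) = coord (c *\<^sub>R slice q x y j) i"
proof (cases "c = 0")
  case True
  then show ?thesis using that[of 0] subspace_cgraphD(1)[OF subspace_W] by (simp add: coord_simps)
next
  case False
  then have xy: "x \<in> labels q" "y \<in> labels q" using assms by auto
  obtain \<psi> where \<psi>: "(\<psi>, ket x \<otimes>\<^sub>v ket y) \<in> W" "\<And>i j. coord \<psi> (i, j) = coord (slice q x y j) i"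
    using W_slice[OF xy] by blast
  show ?thesis
    using that[of "c *\<^sub>R \<psi>"] subspace_cgraphD(3)[OF subspace_W \<psi>(1)] \<psi>(2)
    by (simp add: scaleR_ell2_def coord_simps fbl_labels xy)
qed

lemma W_ladder_comult:
  assumes x: "x \<in> labels q" and y: "y \<in> labels q" and e: "e \<in> {1, -1}"
  obtains u where "(u, ladder_comult q e (\<lambda>l1 l2. fbl l1 \<otimes>\<^sub>v fbl l2) x y) \<in> W"
    "\<And>i j. coord u (i, j) = coord (ladder_comult q e (\<lambda>l1 l2. slice q l1 l2 j) x y) i"
proof -
  obtain m1 p1 t1 m2 p2 t2 where xy: "x = (m1, p1, t1)" "y = (m2, p2, t2)" by (cases x, cases y)
  have I: "p1 \<in> Iq q" "t1 \<in> Iq q" "p2 \<in> Iq q" "t2 \<in> Iq q" using x y by (auto simp: xy labels_def)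
  note z = t_coeff_def[OF q] p_coeff_def[OF q]
  obtain u1 where u1: "(u1, (t_coeff q e (m1, p1, t1) * K_eigen q (m2, p2, t2)) *\<^sub>R
      (fbl (m1 - e, p1, t1 * q powi - e) \<otimes>\<^sub>v fbl (m2, p2, t2))) \<in> W"
    "\<And>i j. coord u1 (i, j) = coord ((t_coeff q e (m1, p1, t1) * K_eigen q (m2, p2, t2)) *\<^sub>R
      slice q (m1 - e, p1, t1 * q powi - e) (m2, p2, t2) j) i"
    by (rule W_slice_scaled[of "(m1 - e, p1, t1 * q powi - e)" "(m2, p2, t2)"
        "t_coeff q e (m1, p1, t1) * K_eigen q (m2, p2, t2)"])
      (use I Iq_shift[OF q e I(2)] in \<open>auto simp: labels_def z\<close>)
  obtain u2 where u2: "(u2, (p_coeff q e (m1, p1, t1) * K_eigen q (m2, p2, t2)) *\<^sub>R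
      (fbl (m1 - e, q powi e * p1, t1) \<otimes>\<^sub>v fbl (m2, p2, t2))) \<in> W"
    "\<And>i j. coord u2 (i, j) = coord ((p_coeff q e (m1, p1, t1) * K_eigen q (m2, p2, t2)) *\<^sub>R
      slice q (m1 - e, q powi e * p1, t1) (m2, p2, t2) j) i"
    by (rule W_slice_scaled[of "(m1 - e, q powi e * p1, t1)" "(m2, p2, t2)"
        "p_coeff q e (m1, p1, t1) * K_eigen q (m2, p2, t2)"])
      (use I Iq_shift'[OF q e I(1)] in \<open>auto simp: labels_def z\<close>)
  obtain u3 where u3: "(u3, (inverse (K_eigen q (m1, p1, t1)) * t_coeff q e (m2, p2, t2)) *\<^sub>R
      (fbl (m1, p1, t1) \<otimes>\<^sub>v fbl (m2 - e, p2, t2 * q powi - e))) \<in> W"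
    "\<And>i j. coord u3 (i, j) = coord ((inverse (K_eigen q (m1, p1, t1)) * t_coeff q e (m2, p2, t2)) *\<^sub>R
      slice q (m1, p1, t1) (m2 - e, p2, t2 * q powi - e) j) i"
    by (rule W_slice_scaled[of "(m1, p1, t1)" "(m2 - e, p2, t2 * q powi - e)"
        "inverse (K_eigen q (m1, p1, t1)) * t_coeff q e (m2, p2, t2)"])
      (use I Iq_shift[OF q e I(4)] in \<open>auto simp: labels_def z\<close>)
  obtain u4 where u4: "(u4, (inverse (K_eigen q (m1, p1, t1)) * p_coeff q e (m2, p2, t2)) *\<^sub>R
      (fbl (m1, p1, t1) \<otimes>\<^sub>v fbl (m2 - e, q powi e * p2, t2))) \<in> W"
    "\<And>i j. coord u4 (i, j) = coord ((inverse (K_eigen q (m1, p1, t1)) * p_coeff q e (m2, p2, t2)) *\<^sub>R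
      slice q (m1, p1, t1) (m2 - e, q powi e * p2, t2) j) i"
    by (rule W_slice_scaled[of "(m1, p1, t1)" "(m2 - e, q powi e * p2, t2)"
        "inverse (K_eigen q (m1, p1, t1)) * p_coeff q e (m2, p2, t2)"])
      (use I Iq_shift'[OF q e I(3)] in \<open>auto simp: labels_def z\<close>)
  note S = subspace_cgraphD(2)[OF subspace_W]
  have "(inverse (q - inverse q) *\<^sub>R (u1 + u2 + u3 + u4),
      ladder_comult q e (\<lambda>l1 l2. fbl l1 \<otimes>\<^sub>v fbl l2) x y) \<in> W"
    unfolding ladder_comult_def[OF q] xy prod.case scaleR_ell2_def[of "inverse (q - inverse q)"]
    by (rule subspace_cgraphD(3)[OF subspace_W S[OF S[OF S[OF u1(1) u2(1)] u3(1)] u4(1)]])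
  moreover have "coord (inverse (q - inverse q) *\<^sub>R (u1 + u2 + u3 + u4)) (i, j)
      = coord (ladder_comult q e (\<lambda>l1 l2. slice q l1 l2 j) x y) i" for i j
    unfolding ladder_comult_def[OF q] xy prod.case coord_simps u1(2) u2(2) u3(2) u4(2) by simp
  ultimately show ?thesis by (rule that)
qed

lemma ladder_comult_tensor:
  assumes "x \<in> labels q" "y \<in> labels q"
  shows "ladder_comult q e (\<lambda>l1 l2. fbl l1 \<otimes>\<^sub>v fbl l2) x y
    = ladder q e x \<otimes>\<^sub>v scaleC (complex_of_real (K_eigen q y)) (ket y)
      + scaleC (complex_of_real (inverse (K_eigen q x))) (ket x) \<otimes>\<^sub>v ladder q e y"
proof -
  obtain m1 p1 t1 m2 p2 t2 where xy: "x = (m1, p1, t1)" "y = (m2, p2, t2)" by (cases x, cases y)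
  show ?thesis
    using fbl_labels[OF assms(1)] fbl_labels[OF assms(2)]
    unfolding ladder_comult_def[OF q] ladder_def[OF q] xy prod.case
    by (intro ell2_eqI) (auto simp: coord_simps coord_tensor fbl_def algebra_simps split: prod.splits)
qed

text \<open>Linearity of the graph of \<open>\<Delta>hat\<close> reduces the inclusion to basis
  vectors. The flip is the reason why \<open>y\<close> precedes \<open>x\<close> in the slices. The
  parameter \<open>A\<close> becomes \<open>E_op\<close> for \<open>e = 1\<close> and
  \<open>E_star\<close> for \<open>e = -1\<close>.\<close>

lemma ladder_comult_\<Delta>hat:
  assumes e: "e \<in> {1, -1}" and A: "basis_op (labels q) (ladder q e) \<subseteq> A"
  shows "(K0 q \<odot> basis_op (labels q) (ladder q e)) +\<^sub>o (basis_op (labels q) (ladder q e) \<odot> (K0 q)\<inverse>)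
    \<subseteq> \<Delta>hat q W A"
proof -
  define k where "k x = scaleC (complex_of_real (K_eigen q x)) (ket x)" for x
  define k' where "k' x = scaleC (complex_of_real (inverse (K_eigen q x))) (ket x)" for x
  define L where "L = ladder q e"
  have "(K0 q \<odot> basis_op (labels q) L) +\<^sub>o (basis_op (labels q) L \<odot> (K0 q)\<inverse>)
      \<subseteq> basis_op (labels q \<times> labels q) (\<lambda>(x, y). k x \<otimes>\<^sub>v L y)
        +\<^sub>o basis_op (labels q \<times> labels q) (\<lambda>(x, y). L x \<otimes>\<^sub>v k' y)"
    using K0_eq[OF q] K0_converse_subset[OF q] alg_tensor_basis_op[of "labels q" k "labels q" L]
      order_trans[OF alg_tensor_mono alg_tensor_basis_op[of "labels q" L "labels q" k']]
    unfolding k_def[symmetric] k'_def[symmetric] by (intro op_plus_mono) auto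
  also have "\<dots> \<subseteq> basis_op (labels q \<times> labels q) (\<lambda>z. (\<lambda>(x, y). k x \<otimes>\<^sub>v L y) z + (\<lambda>(x, y). L x \<otimes>\<^sub>v k' y) z)"
    by (rule basis_op_plus)
  also have "\<dots> \<subseteq> \<Delta>hat q W A"
  proof (rule basis_op_minimal[OF subspace_\<Delta>hat])
    fix z assume "z \<in> labels q \<times> labels q"
    then obtain x y where z: "z = (x, y)" and xy: "x \<in> labels q" "y \<in> labels q" by blast
    obtain m1 p1 t1 m2 p2 t2 where xy': "x = (m1, p1, t1)" "y = (m2, p2, t2)" by (cases x, cases y)
    obtain \<psi> where \<psi>: "(\<psi>, ket y \<otimes>\<^sub>v ket x) \<in> W" "\<And>i j. coord \<psi> (i, j) = coord (slice q y x j) i"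
      using W_slice[OF xy(2,1)] by blast
    obtain u where u: "(u, ladder_comult q e (\<lambda>l1 l2. fbl l1 \<otimes>\<^sub>v fbl l2) y x) \<in> W"
      "\<And>i j. coord u (i, j) = coord (ladder_comult q e (\<lambda>l1 l2. slice q l1 l2 j) y x) i"
      using W_ladder_comult[OF xy(2,1) e] by blast
    have "(slice q y x j, ladder_comult q e (\<lambda>l1 l2. slice q l1 l2 j) y x) \<in> basis_op (labels q) (ladder q e)" for j
      using slice_ladder[OF q _ _ _ _ e] xy unfolding xy' by (auto simp: labels_def)
    then have "\<exists>v v'. (v, v') \<in> basis_op (labels q) (ladder q e)
        \<and> (\<forall>i. coord \<psi> (i, j) = coord v i \<and> coord u (i, j) = coord v' i)" for j
      using \<psi>(2) u(2) by metis
    \<comment> \<open>That \<open>u\<close> is a vector at all comes from \<open>W\<close> being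
      onto; this replaces a convergence estimate for the images of the slices.\<close>
    moreover have "\<psi> \<in> supported_on (labels q \<times> labels q)" "u \<in> supported_on (labels q \<times> labels q)"
      using W_in_\<K>\<K> \<psi>(1) u(1) unfolding \<K>\<K>_def by blast+
    ultimately have "(\<psi>, u) \<in> basis_op (labels q) (ladder q e) \<otimes>\<^sub>o Id_on (\<K> q)"
      unfolding \<K>_def by (rule closed_tensor_Id_slices)
    then have "(\<psi>, u) \<in> A \<otimes>\<^sub>o Id_on (\<K> q)"
      using closure_mono[OF alg_tensor_mono[OF A order_refl]] unfolding closed_tensor_def by blast
    moreover have "swap_ell2 (k x \<otimes>\<^sub>v L y + L x \<otimes>\<^sub>v k' y)
        = ladder_comult q e (\<lambda>l1 l2. fbl l1 \<otimes>\<^sub>v fbl l2) y x"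
      unfolding ladder_comult_tensor[OF xy(2,1)] swap_add swap_tensor by (simp add: k_def k'_def L_def)
    moreover have "swap_ell2 (ket (x, y)) = ket y \<otimes>\<^sub>v ket x" by (simp add: ket_Pair swap_tensor)
    ultimately have "(ket (x, y), k x \<otimes>\<^sub>v L y + L x \<otimes>\<^sub>v k' y) \<in> \<Delta>hat q W A"
      unfolding \<Delta>hat_iff using \<psi>(1) u(1) ket_\<K>\<K>[of "(x, y)" q] xy by auto
    then show "(ket z, (case z of (x, y) \<Rightarrow> k x \<otimes>\<^sub>v L y) + (case z of (x, y) \<Rightarrow> L x \<otimes>\<^sub>v k' y)) \<in> \<Delta>hat q W A"
      by (simp add: z)
  qed
  finally show ?thesis unfolding L_def .
qed

text \<open>Equality needs full domains, so both inclusions are checked coordinatewise. For the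
  first, coordinates of the flipped \<open>w\<close> are inner products of \<open>b'\<close> with
  the eigenvectors \<open>\<psi>\<close>. For the second, the expansion of \<open>W (ket i)\<close>
  is needed.\<close>

lemma K_op_\<Delta>hat: "\<Delta>hat q W (K_op q) = K_op q \<otimes>\<^sub>o K_op q"
proof -
  define k where "k x = complex_of_real (K_eigen q x)" for x
  define L where "L = labels q \<times> labels q"
  have M: "K_op q \<otimes>\<^sub>o Id_on (\<K> q) = mult_op L (\<lambda>(x, y). k x)"
    unfolding K_op_eq[OF q] \<K>_def Id_on_supported_on mult_op_tensor L_def k_def by simp
  have KK: "K_op q \<otimes>\<^sub>o K_op q = mult_op L (\<lambda>(x, y). k x * k y)"
    unfolding K_op_eq[OF q] mult_op_tensor L_def k_def ..
  have HL: "\<K>\<K> q = supported_on L" by (simp add: \<K>\<K>_def L_def)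
  have eig: "\<exists>\<psi>. (\<psi>, ket l) \<in> W \<and> (\<forall>i. coord \<psi> i \<noteq> 0 \<longrightarrow> (\<lambda>(x, y). k x) i = (\<lambda>(x, y). k x * k y) l)"
    if "l \<in> L" for l
  proof -
    obtain m1 p1 t1 m2 p2 t2 where l: "l = ((m1, p1, t1), (m2, p2, t2))" by (cases l) auto
    have I: "p1 \<in> Iq q" "t1 \<in> Iq q" "p2 \<in> Iq q" "t2 \<in> Iq q" using that by (auto simp: l L_def labels_def)
    obtain \<psi> where \<psi>: "(\<psi>, ket (m1, p1, t1) \<otimes>\<^sub>v ket (m2, p2, t2)) \<in> W"
      "\<And>i j. coord \<psi> (i, j) = coord (slice q (m1, p1, t1) (m2, p2, t2) j) i"
      using W_slice[of "(m1, p1, t1)" "(m2, p2, t2)"] I by (auto simp: labels_def)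
    have "k i = k (m1, p1, t1) * k (m2, p2, t2)" if "coord \<psi> (i, j) \<noteq> 0" for i j
      using slice_support(1)[OF q I that[unfolded \<psi>(2)]] by (simp add: k_def)
    then show ?thesis using \<psi>(1) unfolding l ket_Pair by (intro exI[of _ \<psi>]) auto
  qed
  show ?thesis
  proof (rule set_eqI, clarify)
    fix v w
    have sym: "(swap_ell2 v, swap_ell2 w) \<in> mult_op L (\<lambda>(x, y). k x * k y)
        \<longleftrightarrow> (v, w) \<in> mult_op L (\<lambda>(x, y). k x * k y)"
      using swap_\<K>\<K>[of _ q] by (auto simp: mult_op_def HL coord_swap mult.commute)
    show "(v, w) \<in> \<Delta>hat q W (K_op q) \<longleftrightarrow> (v, w) \<in> K_op q \<otimes>\<^sub>o K_op q"
    proof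
      assume "(v, w) \<in> \<Delta>hat q W (K_op q)"
      then obtain b b' where b: "(b, swap_ell2 v) \<in> W" "(b, b') \<in> mult_op L (\<lambda>(x, y). k x)"
        "(b', swap_ell2 w) \<in> W" unfolding \<Delta>hat_iff M by blast
      have bb: "coord b' i = (\<lambda>(x, y). k x) i * coord b i" for i
        using b(2) unfolding mult_op_def by blast
      have H: "swap_ell2 v \<in> supported_on L" "swap_ell2 w \<in> supported_on L"
        using b W_in_\<K>\<K> HL by auto
      have "coord (swap_ell2 w) l = (\<lambda>(x, y). k x * k y) l * coord (swap_ell2 v) l" for l
      proof (cases "l \<in> L")
        case True
        then obtain \<psi> where \<psi>: "(\<psi>, ket l) \<in> W"
          "\<And>i. coord \<psi> i \<noteq> 0 \<Longrightarrow> (\<lambda>(x, y). k x) i = (\<lambda>(x, y). k x * k y) l" using eig by blast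
        have "coord (swap_ell2 w) l = cinner b' \<psi>"
          using unitary_on_cinner[OF unitary_W b(3) \<psi>(1)] by (simp add: cinner_ket_right)
        also have "\<dots> = (\<lambda>(x, y). k x * k y) l * cinner b \<psi>"
          by (intro cinner_mult_left) (drule \<psi>(2), simp only: bb)
        also have "cinner b \<psi> = coord (swap_ell2 v) l"
          using unitary_on_cinner[OF unitary_W b(1) \<psi>(1)] by (simp add: cinner_ket_right)
        finally show ?thesis .
      next
        case False
        then have "coord (swap_ell2 v) l = 0" "coord (swap_ell2 w) l = 0"
          using H unfolding supported_on_def by blast+
        then show ?thesis by simp
      qed
      then show "(v, w) \<in> K_op q \<otimes>\<^sub>o K_op q"
        unfolding KK sym[symmetric] using H by (simp add: mult_op_def)
    next
      assume "(v, w) \<in> K_op q \<otimes>\<^sub>o K_op q"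
      then have a: "(swap_ell2 v, swap_ell2 w) \<in> mult_op L (\<lambda>(x, y). k x * k y)" unfolding KK sym .
      then have aa: "coord (swap_ell2 w) l = (\<lambda>(x, y). k x * k y) l * coord (swap_ell2 v) l" for l
        unfolding mult_op_def by blast
      from a have H: "swap_ell2 v \<in> \<K>\<K> q" "swap_ell2 w \<in> \<K>\<K> q" by (auto simp: mult_op_def HL)
      obtain b where b: "(b, swap_ell2 v) \<in> W" using H(1) unitary_W unfolding unitary_on_def by blast
      obtain b' where b': "(b', swap_ell2 w) \<in> W" using H(2) unitary_W unfolding unitary_on_def by blast
      have Hb: "b \<in> supported_on L" "b' \<in> supported_on L" using b b' W_in_\<K>\<K> HL by auto
      have "coord b' i = (\<lambda>(x, y). k x) i * coord b i" for i
      proof (cases "i \<in> L")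
        case True
        then have "ket i \<in> \<K>\<K> q" by (simp add: HL ket_in_supported_on)
        then obtain g where g: "(ket i, g) \<in> W" using unitary_W unfolding unitary_on_def by blast
        \<comment> \<open>\<open>g\<close> is \<open>W (ket i)\<close>, and its coordinate at
          \<open>l\<close> is conjugate to the coordinate of an eigenvector at \<open>i\<close>.
          Hence \<open>g\<close> only meets labels \<open>l\<close> whose eigenvalue for
          \<open>K \<otimes> K\<close> is that of \<open>i\<close> for
          \<open>K \<otimes> 1\<close>.\<close>
        have k: "(\<lambda>(x, y). k x * k y) l = (\<lambda>(x, y). k x) i" if "coord g l \<noteq> 0" for l
        proof -
          have "g \<in> supported_on L" using g W_in_\<K>\<K> HL by auto
          then have "l \<in> L" using that unfolding supported_on_def by blast
          then obtain \<psi> where \<psi>: "(\<psi>, ket l) \<in> W"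
            "\<And>i. coord \<psi> i \<noteq> 0 \<Longrightarrow> (\<lambda>(x, y). k x) i = (\<lambda>(x, y). k x * k y) l" using eig by blast
          have "coord g l = cnj (coord \<psi> i)"
            using unitary_on_cinner[OF unitary_W g \<psi>(1)] by (simp add: cinner_ket_right cinner_ket_left coord_ket)
          then show ?thesis using that \<psi>(2)[of i] by auto
        qed
        have "coord b' i = cinner (swap_ell2 w) g"
          using unitary_on_cinner[OF unitary_W b' g] by (simp add: cinner_ket_right)
        also have "\<dots> = (\<lambda>(x, y). k x) i * cinner (swap_ell2 v) g"
          by (intro cinner_mult_left) (drule k, simp only: aa)
        also have "cinner (swap_ell2 v) g = coord b i"
          using unitary_on_cinner[OF unitary_W b g] by (simp add: cinner_ket_right)
        finally show ?thesis .
      next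
        case False
        then have "coord b i = 0" "coord b' i = 0" using Hb unfolding supported_on_def by blast+
        then show ?thesis by simp
      qed
      then have "(b, b') \<in> mult_op L (\<lambda>(x, y). k x)" using Hb by (simp add: mult_op_def)
      then show "(v, w) \<in> \<Delta>hat q W (K_op q)"
        unfolding \<Delta>hat_iff M using b b' H(1) swap_\<K>\<K> by blast
    qed
  qed
qed

end

theorem proposition4p14:
  fixes q :: real and W :: "(lab \<times> lab, lab \<times> lab) operator"
  assumes "0 < q" and "q < 1"
    and "is_W q W"
  shows "\<Delta>hat q W (K_op q) = K_op q \<otimes>\<^sub>o K_op q \<and>
    (K0 q \<odot> E0 q) +\<^sub>o (E0 q \<odot> (K0 q)\<inverse>) \<subseteq> \<Delta>hat q W (E_op q) \<and>
    (K0 q \<odot> E0_dag q) +\<^sub>o (E0_dag q \<odot> (K0 q)\<inverse>) \<subseteq> \<Delta>hat q W (E_star q)"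
proof (intro conjI)
  note q = assms(1,2)
  show "\<Delta>hat q W (K_op q) = K_op q \<otimes>\<^sub>o K_op q" by (rule K_op_\<Delta>hat[OF assms])
  have "basis_op (labels q) (ladder q 1) \<subseteq> E_op q"
    unfolding E_op_def E0_eq[OF q] by (rule closure_subset)
  then show "(K0 q \<odot> E0 q) +\<^sub>o (E0 q \<odot> (K0 q)\<inverse>) \<subseteq> \<Delta>hat q W (E_op q)"
    unfolding E0_eq[OF q] by (intro ladder_comult_\<Delta>hat[OF assms]) auto
  have "(K0 q \<odot> E0_dag q) +\<^sub>o (E0_dag q \<odot> (K0 q)\<inverse>)
      \<subseteq> (K0 q \<odot> basis_op (labels q) (ladder q (-1))) +\<^sub>o (basis_op (labels q) (ladder q (-1)) \<odot> (K0 q)\<inverse>)"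
    by (intro op_plus_mono alg_tensor_mono E0_dag_subset[OF q] order_refl)
  also have "\<dots> \<subseteq> \<Delta>hat q W (E_star q)"
    by (intro ladder_comult_\<Delta>hat[OF assms] basis_op_ladder_subset_E_star[OF q]) auto
  finally show "(K0 q \<odot> E0_dag q) +\<^sub>o (E0_dag q \<odot> (K0 q)\<inverse>) \<subseteq> \<Delta>hat q W (E_star q)" .
qed

end
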